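(* Fix $\omega\in\Omega$. Then $-1/\alpha_0\le\min_{\mathbb R\times\mathbb R}H(\cdot,\cdot,\omega)\le\lambda_0(\omega)\le\alpha_1$, and for every $\lambda\ge\lambda_0(\omega)$ there exists a viscosity solution $u$ of $a(x,\omega)u''+H(x,u',\omega)=\lambda$ in $\mathbb R$. Moreover $u$ is $K$-Lipschitz on $\mathbb R$ with $K$ depending only on $\alpha_0,\alpha_1,\gamma,\kappa,\lambda$, and $u$ is of class $C^2$ on every open interval contained in $\{a(\cdot,\omega)>0\}$.
   Context: $a:\mathbb R\times\Omega\to[0,1]$ with $\sqrt{a(\cdot,\omega)}$ $\kappa$-Lipschitz for every $\omega$; $H(\cdot,\cdot,\omega)\in\mathscr H(\alpha_0,\alpha_1,\gamma)$ for every $\omega$ with $\gamma>2$, where $\mathscr H(\alpha_0,\alpha_1,\gamma)$ is the class of $H$ with (H1) $\alpha_0|p|^\gamma-1/\alpha_0\le H(x,p,\omega)\le\alpha_1(|p|^\gamma+1)$, (H2) $|H(x,p,\omega)-H(x,q,\omega)|\le\alpha_1(|p|+|q|+1)^{\gamma-1}|p-q|$, (H3) $|H(x,p,\omega)-H(y,p,\omega)|\le\alpha_1(|p|^\gamma+1)|x-y|$. Viscosity conventions: supersolution means $a\varphi''+H(x,\varphi')\le\lambda$ at points where a $C^2$ $\varphi$ touches $u$ from below; subsolution means $\ge\lambda$ for $\varphi$ touching from above. $\lambda_0(\omega):=\inf\{\lambda:\ a(x,\omega)u''+H(x,u',\omega)=\lambda$ admits a continuous viscosity supersolution on $\mathbb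 R\}$.
   Formalization: The minimum of H over ℝ×ℝ is replaced by the infimum, since the minimum need not be attained (e.g. H = |p|^γ + 1/(1+x²)); the two agree whenever the minimum exists. *)

theory Defs
  imports "HOL-Analysis.Analysis"
begin

definition Hclass :: "real \<Rightarrow> real \<Rightarrow> real \<Rightarrow> (real \<Rightarrow> real \<Rightarrow> real) \<Rightarrow> bool" where
  "Hclass \<alpha>0 \<alpha>1 \<gamma> H \<longleftrightarrow>
     (\<forall>x p. \<alpha>0 * \<bar>p\<bar> powr \<gamma> - 1 / \<alpha>0 \<le> H x p \<and> H x p \<le> \<alpha>1 * (\<bar>p\<bar> powr \<gamma> + 1)) \<and>
     (\<forall>x p q. \<bar>H x p - H x q\<bar> \<le> \<alpha>1 * (\<bar>p\<bar> + \<bar>q\<bar> + 1) powr (\<gamma> - 1) * \<bar>p - q\<bar>) \<and>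
     (\<forall>x y p. \<bar>H x p - H y p\<bar> \<le> \<alpha>1 * (\<bar>p\<bar> powr \<gamma> + 1) * \<bar>x - y\<bar>)"

definition C2 :: "(real \<Rightarrow> real) \<Rightarrow> bool" where
  "C2 \<phi> \<longleftrightarrow> \<phi> differentiable_on UNIV \<and> deriv \<phi> differentiable_on UNIV
              \<and> continuous_on UNIV (deriv (deriv \<phi>))"

definition C2_on :: "real set \<Rightarrow> (real \<Rightarrow> real) \<Rightarrow> bool" where
  "C2_on I f \<longleftrightarrow> f differentiable_on I \<and> deriv f differentiable_on I
              \<and> continuous_on I (deriv (deriv f))"

definition touches_below :: "(real \<Rightarrow> real) \<Rightarrow> (real \<Rightarrow> real) \<Rightarrow> real \<Rightarrow> bool" where
  "touches_below \<phi> u x \<longleftrightarrow> \<phi> x = u x \<and> (\<exists>\<delta>>0. \<forall>y. \<bar>y - x\<bar> < \<delta> \<longrightarrow> \<phi> y \<le> u y)"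

definition touches_above :: "(real \<Rightarrow> real) \<Rightarrow> (real \<Rightarrow> real) \<Rightarrow> real \<Rightarrow> bool" where
  "touches_above \<phi> u x \<longleftrightarrow> \<phi> x = u x \<and> (\<exists>\<delta>>0. \<forall>y. \<bar>y - x\<bar> < \<delta> \<longrightarrow> u y \<le> \<phi> y)"

definition visc_super :: "(real \<Rightarrow> real) \<Rightarrow> (real \<Rightarrow> real \<Rightarrow> real) \<Rightarrow> real \<Rightarrow> (real \<Rightarrow> real) \<Rightarrow> bool" where
  "visc_super a H lam u \<longleftrightarrow> continuous_on UNIV u \<and>
     (\<forall>\<phi> x. C2 \<phi> \<and> touches_below \<phi> u x \<longrightarrow> a x * deriv (deriv \<phi>) x + H x (deriv \<phi> x) \<le> lam)"

definition visc_sub :: "(real \<Rightarrow> real) \<Rightarrow> (real \<Rightarrow> real \<Rightarrow> real) \<Rightarrow> real \<Rightarrow> (real \<Rightarrow> real) \<Rightarrow> bool" where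
  "visc_sub a H lam u \<longleftrightarrow> continuous_on UNIV u \<and>
     (\<forall>\<phi> x. C2 \<phi> \<and> touches_above \<phi> u x \<longrightarrow> a x * deriv (deriv \<phi>) x + H x (deriv \<phi> x) \<ge> lam)"

definition visc_sol :: "(real \<Rightarrow> real) \<Rightarrow> (real \<Rightarrow> real \<Rightarrow> real) \<Rightarrow> real \<Rightarrow> (real \<Rightarrow> real) \<Rightarrow> bool" where
  "visc_sol a H lam u \<longleftrightarrow> visc_super a H lam u \<and> visc_sub a H lam u"

definition lambda0 :: "(real \<Rightarrow> real) \<Rightarrow> (real \<Rightarrow> real \<Rightarrow> real) \<Rightarrow> real" where
  "lambda0 a H = Inf {lam. \<exists>u. visc_super a H lam u}"

end

theory Submission
  imports Defs "HOL-Complex_Analysis.Great_Picard"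
begin

text \<open>
  In dimension one a logarithmic barrier shows that every supersolution on the line is Lipschitz,
  with a constant depending only on \<open>\<alpha>0\<close> and \<open>\<lambda>\<close>. The set of admissible levels is therefore
  closed, so supersolutions exist for every \<open>\<lambda> \<ge> \<lambda>\<^sub>0\<close>. By Perron's argument the
  infimum of all supersolutions vanishing at a point \<open>y\<close> is a solution on \<open>\<real> - {y}\<close>; normalising
  these at the origin and letting \<open>y \<rightarrow> \<infinity>\<close> along a subsequence gives a solution on the line.
  Where \<open>a > 0\<close> the equation bounds \<open>u''\<close> from both sides in the viscosity sense, which first
  makes \<open>u'\<close> locally Lipschitz and then identifies \<open>u''\<close> with the continuous function
  \<open>(\<lambda> - H(x, u')) / a\<close>.
\<close>

section \<open>Quadratic test functions\<close>

text \<open>The sign convention fixes the direction of the construction. In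
  \<open>a u'' + H \<le> l\<close> the growth of \<open>H\<close> limits the slope of a
  supersolution, whereas a subsolution may be arbitrarily steep. So a priori bounds exist for
  supersolutions alone; they form an equi-Lipschitz family at each level, and infima of them are
  taken, without any comparison principle. Adding a constant to a supersolution gives another one,
  so an infimum over all of them would be minus infinity; prescribing the value at one point
  \<open>y\<close> removes this freedom. The price is paid at \<open>y\<close> alone: a competitor
  built by cutting out a piece of the infimum must keep its value there, so the subsolution test can
  be carried out only away from \<open>y\<close>. Since \<open>a\<close> may vanish, a bound on
  \<open>u''\<close> can be extracted only locally inside \<open>{a > 0}\<close>, which is why
  regularity is a separate and local argument.\<close>

definition below_jet :: "(real \<Rightarrow> real) \<Rightarrow> real \<Rightarrow> real \<Rightarrow> real \<Rightarrow> bool" where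
  "below_jet u x p q \<longleftrightarrow> (\<exists>\<delta>>0. \<forall>z. \<bar>z - x\<bar> < \<delta> \<longrightarrow> u x + p * (z - x) + q * (z - x)\<^sup>2 \<le> u z)"

definition super_at :: "(real \<Rightarrow> real) \<Rightarrow> (real \<Rightarrow> real \<Rightarrow> real) \<Rightarrow> real \<Rightarrow> (real \<Rightarrow> real) \<Rightarrow> real \<Rightarrow> bool" where
  "super_at a H l u x \<longleftrightarrow> (\<forall>p q. below_jet u x p q \<longrightarrow> a x * (2 * q) + H x p \<le> l)"

text \<open>The substitution of \<open>- u\<close> for \<open>u\<close> exchanges touching from
  above with touching from below and replaces \<open>H x p\<close> by \<open>- H x (- p)\<close>,
  while \<open>a\<close> keeps its sign. Statements about supersolutions that do not use the growth
  of \<open>H\<close> thus apply to subsolutions as well.\<close>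

definition sub_at :: "(real \<Rightarrow> real) \<Rightarrow> (real \<Rightarrow> real \<Rightarrow> real) \<Rightarrow> real \<Rightarrow> (real \<Rightarrow> real) \<Rightarrow> real \<Rightarrow> bool" where
  "sub_at a H l u x \<longleftrightarrow> super_at a (\<lambda>x p. - H x (- p)) (- l) (\<lambda>z. - u z) x"

lemma super_atD: "super_at a H l u x \<Longrightarrow> below_jet u x p q \<Longrightarrow> a x * (2 * q) + H x p \<le> l"
  by (simp add: super_at_def)

lemma super_at_mono: "super_at a H l u x \<Longrightarrow> l \<le> l' \<Longrightarrow> super_at a H l' u x"
  unfolding super_at_def by force

lemma super_at_shift: "super_at a H l (\<lambda>z. u z - c) x \<longleftrightarrow> super_at a H l u x"
  by (simp add: super_at_def below_jet_def algebra_simps)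

lemma sub_at_shift: "sub_at a H l (\<lambda>z. u z - c) x \<longleftrightarrow> sub_at a H l u x"
  using super_at_shift[of a "\<lambda>x p. - H x (- p)" "- l" "\<lambda>z. - u z" "- c" x]
  by (simp add: sub_at_def algebra_simps)

lemma isCont_less_nbhd:
  fixes f :: "real \<Rightarrow> real"
  assumes "isCont f x" "f x < c"
  shows "\<exists>d>0. \<forall>z. \<bar>z - x\<bar> < d \<longrightarrow> f z < c"
proof -
  have "(f \<longlongrightarrow> f x) (nhds x)"
    using assms(1) by (simp add: isCont_def tendsto_at_iff_tendsto_nhds)
  then have "\<forall>\<^sub>F z in nhds x. f z < c" using assms(2) by (rule order_tendstoD)
  then show ?thesis by (simp add: eventually_nhds_metric dist_real_def)
qed

lemma linear_plus_square_nonneg: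
  fixes A B :: real
  assumes "0 < \<delta>" and "\<And>h. \<bar>h\<bar> < \<delta> \<Longrightarrow> 0 \<le> A * h + B * h\<^sup>2"
  shows "A = 0" and "0 \<le> B"
proof -
  have "((\<lambda>h. A * h + B * h\<^sup>2) has_real_derivative A) (at 0)"
    by (auto intro!: derivative_eq_intros)
  from DERIV_local_min[OF this assms(1)] assms(2) show A: "A = 0"
    by simp
  have "0 \<le> A * (\<delta> / 2) + B * (\<delta> / 2)\<^sup>2"
    using assms by (intro assms(2)) auto
  then show "0 \<le> B"
    using A assms(1) by (simp add: zero_le_mult_iff)
qed

lemma below_jet_parabola:
  assumes "below_jet (\<lambda>z. c + P * (z - x) + Q * (z - x)\<^sup>2) y p q"
  shows "p = P + 2 * Q * (y - x)" and "q \<le> Q"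
proof -
  obtain \<delta> where \<delta>: "\<delta> > 0" and le: "\<And>z. \<bar>z - y\<bar> < \<delta> \<Longrightarrow>
      c + P * (y - x) + Q * (y - x)\<^sup>2 + p * (z - y) + q * (z - y)\<^sup>2 \<le> c + P * (z - x) + Q * (z - x)\<^sup>2"
    using assms unfolding below_jet_def by auto
  have "0 \<le> (P + 2 * Q * (y - x) - p) * h + (Q - q) * h\<^sup>2" if "\<bar>h\<bar> < \<delta>" for h
    using le[of "y + h"] that by (simp add: algebra_simps power2_eq_square)
  from linear_plus_square_nonneg[OF \<delta> this] show "p = P + 2 * Q * (y - x)" "q \<le> Q"
    by auto
qed

lemma below_jet_lipschitz:
  assumes "below_jet u x p q" and "K-lipschitz_on UNIV u"
  shows "\<bar>p\<bar> \<le> K"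
proof -
  obtain \<delta> where \<delta>: "\<delta> > 0"
    and le: "\<And>z. \<bar>z - x\<bar> < \<delta> \<Longrightarrow> u x + p * (z - x) + q * (z - x)\<^sup>2 \<le> u z"
    using assms unfolding below_jet_def by auto
  have K: "u z \<le> u x + K * \<bar>z - x\<bar>" for z
    using lipschitz_onD[OF assms(2), of z x] by (auto simp: dist_real_def)
  have *: "s * p \<le> K" if s: "\<bar>s\<bar> = 1" for s :: real
  proof (rule tendsto_upperbound)
    show "((\<lambda>h. s * p + q * h) \<longlongrightarrow> s * p) (at_right 0)"
      by (auto intro!: tendsto_eq_intros)
    have "s * p + q * h \<le> K" if h: "0 < h" "h < \<delta>" for h
    proof -
      have "s * s = 1" using s by (metis abs_mult_self_eq mult_1)
      then have "h * (s * p + q * h) \<le> h * K"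
        using le[of "x + s * h"] K[of "x + s * h"] h s
        by (simp add: abs_mult power2_eq_square algebra_simps)
      then show ?thesis using h by simp
    qed
    then show "\<forall>\<^sub>F h in at_right 0. s * p + q * h \<le> K"
      using \<delta> eventually_at_right_less eventually_at_right by blast
  qed simp
  from *[of 1] *[of "-1"] show ?thesis by simp
qed

lemma below_jet_deriv:
  assumes "below_jet u x p q" and "(u has_real_derivative d) (at x)"
  shows "p = d"
proof -
  obtain \<delta> where \<delta>: "\<delta> > 0"
    and le: "\<And>z. \<bar>z - x\<bar> < \<delta> \<Longrightarrow> u x + p * (z - x) + q * (z - x)\<^sup>2 \<le> u z"
    using assms unfolding below_jet_def by auto
  have "((\<lambda>z. u z - p * (z - x) - q * (z - x)\<^sup>2) has_real_derivative d - p) (at x)"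
    by (auto intro!: derivative_eq_intros assms(2))
  from DERIV_local_min[OF this \<delta>] show ?thesis
    using le by (force simp: abs_minus_commute)
qed

lemma super_at_touching:
  assumes sup: "super_at a H l u x"
    and r: "0 < r" and d1: "\<And>z. \<bar>z - x\<bar> < r \<Longrightarrow> (\<phi> has_real_derivative \<phi>' z) (at z)"
    and d2: "(\<phi>' has_real_derivative d) (at x)"
    and eq: "\<phi> x = u x" and le: "\<And>z. \<bar>z - x\<bar> < r \<Longrightarrow> \<phi> z \<le> u z"
  shows "a x * d + H x (\<phi>' x) \<le> l"
proof (rule tendsto_upperbound)
  show "((\<lambda>e. a x * (d - 2 * e) + H x (\<phi>' x)) \<longlongrightarrow> a x * d + H x (\<phi>' x)) (at_right 0)"
    by (auto intro!: tendsto_eq_intros)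
  have "a x * (d - 2 * e) + H x (\<phi>' x) \<le> l" if e: "e > 0" for e
  proof -
    have "(\<lambda>z. (\<phi>' z - \<phi>' x) / (z - x)) \<midarrow>x\<rightarrow> d"
      using d2 by (simp add: has_field_derivative_iff)
    then have "\<forall>\<^sub>F z in at x. (\<phi>' z - \<phi>' x) / (z - x) > d - 2 * e"
      using e by (intro order_tendstoD) auto
    then obtain s where s: "s > 0"
      and gt: "\<And>z. z \<noteq> x \<Longrightarrow> \<bar>z - x\<bar> < s \<Longrightarrow> (\<phi>' z - \<phi>' x) / (z - x) > d - 2 * e"
      by (auto simp: eventually_at dist_real_def)
    define g where "g z = \<phi> z - \<phi> x - \<phi>' x * (z - x) - (d / 2 - e) * (z - x)\<^sup>2" for z
    have g': "(g has_real_derivative \<phi>' z - \<phi>' x - (d - 2 * e) * (z - x)) (at z)"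
      if "\<bar>z - x\<bar> < r" for z
      unfolding g_def
      by (rule derivative_eq_intros d1 that refl | simp add: algebra_simps)+
    have "0 \<le> g z" if z: "\<bar>z - x\<bar> < min r s" for z
    proof (cases z x rule: linorder_cases)
      case less
      have "g x \<le> g z"
      proof (rule DERIV_nonpos_imp_nonincreasing[OF less_imp_le[OF less]])
        fix t assume t: "z \<le> t" "t \<le> x"
        have "\<phi>' t - \<phi>' x - (d - 2 * e) * (t - x) \<le> 0"
        proof (cases "t = x")
          case False
          then show ?thesis using gt[of t] t z by (simp add: field_simps)
        qed simp
        then show "\<exists>y. (g has_real_derivative y) (at t) \<and> y \<le> 0"
          using g'[of t] t z by auto
      qed
      then show ?thesis by (simp add: g_def)
    next
      case greater
      have "g x \<le> g z"
      proof (rule DERIV_nonneg_imp_nondecreasing[OF less_imp_le[OF greater]])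
        fix t assume t: "x \<le> t" "t \<le> z"
        have "\<phi>' t - \<phi>' x - (d - 2 * e) * (t - x) \<ge> 0"
        proof (cases "t = x")
          case False
          then show ?thesis using gt[of t] t z by (simp add: field_simps)
        qed simp
        then show "\<exists>y. (g has_real_derivative y) (at t) \<and> 0 \<le> y"
          using g'[of t] t z by auto
      qed
      then show ?thesis by (simp add: g_def)
    qed (simp add: g_def)
    then have "below_jet u x (\<phi>' x) (d / 2 - e)"
      unfolding below_jet_def using r s le eq
      by (intro exI[of _ "min r s"]) (force simp: g_def)
    from super_atD[OF sup this] show ?thesis by (simp add: algebra_simps)
  qed
  then show "\<forall>\<^sub>F e in at_right 0. a x * (d - 2 * e) + H x (\<phi>' x) \<le> l"
    using eventually_at_right_less by (rule eventually_mono[rotated])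
qed simp

lemma C2_iff_has_derivs:
  "C2 \<phi> \<longleftrightarrow> (\<forall>z. (\<phi> has_real_derivative deriv \<phi> z) (at z)) \<and>
     (\<forall>z. (deriv \<phi> has_real_derivative deriv (deriv \<phi>) z) (at z)) \<and> continuous_on UNIV (deriv (deriv \<phi>))"
  by (simp add: C2_def differentiable_on_def DERIV_deriv_iff_real_differentiable)

lemma deriv_parabola:
  fixes c p q x :: real
  shows "deriv (\<lambda>z. c + p * (z - x) + q * (z - x)\<^sup>2) = (\<lambda>z. p + 2 * q * (z - x))"
    and "deriv (\<lambda>z. p + 2 * q * (z - x)) = (\<lambda>z. 2 * q)"
  by (auto intro!: DERIV_imp_deriv derivative_eq_intros)

lemma C2_parabola:
  fixes c p q x :: real
  shows "C2 (\<lambda>z. c + p * (z - x) + q * (z - x)\<^sup>2)"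
  unfolding C2_iff_has_derivs deriv_parabola
  by (auto intro!: derivative_eq_intros)

text \<open>Parabolas are themselves \<open>C2\<close>, and a general \<open>C2\<close> test
  function reduces to them by \<open>super_at_touching\<close>. From here on viscosity inequalities
  are checked on jets.\<close>

lemma visc_super_iff:
  "visc_super a H l u \<longleftrightarrow> continuous_on UNIV u \<and> (\<forall>x. super_at a H l u x)"
proof (intro iffI conjI allI)
  fix x assume *: "visc_super a H l u"
  show "super_at a H l u x"
    unfolding super_at_def
  proof (intro allI impI)
    fix p q assume "below_jet u x p q"
    then have "touches_below (\<lambda>z. u x + p * (z - x) + q * (z - x)\<^sup>2) u x"
      by (auto simp: below_jet_def touches_below_def)
    from *[unfolded visc_super_def, THEN conjunct2, rule_format, OF conjI[OF C2_parabola this]]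
    show "a x * (2 * q) + H x p \<le> l"
      unfolding deriv_parabola by simp
  qed
next
  assume *: "continuous_on UNIV u \<and> (\<forall>x. super_at a H l u x)"
  show "visc_super a H l u"
    unfolding visc_super_def
  proof (intro conjI allI impI)
    fix \<phi> x assume "C2 \<phi> \<and> touches_below \<phi> u x"
    then obtain \<delta> where "C2 \<phi>" "\<delta> > 0" "\<phi> x = u x" "\<And>y. \<bar>y - x\<bar> < \<delta> \<Longrightarrow> \<phi> y \<le> u y"
      unfolding touches_below_def by auto
    then show "a x * deriv (deriv \<phi>) x + H x (deriv \<phi> x) \<le> l"
      using * by (intro super_at_touching[of a H l u x \<delta> \<phi>]) (auto simp: C2_iff_has_derivs)
  qed (use * in auto)
qed (auto simp: visc_super_def)

lemma visc_subI:
  assumes cont: "continuous_on UNIV u" and sub: "\<And>x. sub_at a H l u x"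
  shows "visc_sub a H l u"
  unfolding visc_sub_def
proof (intro conjI allI impI cont)
  fix \<phi> x assume "C2 \<phi> \<and> touches_above \<phi> u x"
  then obtain \<delta> where \<phi>: "C2 \<phi>" "\<delta> > 0" "\<phi> x = u x" "\<And>y. \<bar>y - x\<bar> < \<delta> \<Longrightarrow> u y \<le> \<phi> y"
    unfolding touches_above_def by auto
  have "a x * (- deriv (deriv \<phi>) x) + - H x (- (- deriv \<phi> x)) \<le> - l"
    by (rule super_at_touching[OF sub[unfolded sub_at_def], of \<delta> x "\<lambda>z. - \<phi> z" "\<lambda>z. - deriv \<phi> z"])
      (use \<phi> in \<open>auto simp: C2_iff_has_derivs intro!: derivative_eq_intros\<close>)
  then show "l \<le> a x * deriv (deriv \<phi>) x + H x (deriv \<phi> x)" by simp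
qed

section \<open>Stability\<close>

text \<open>The hypothesis covers both infima of families and locally uniform limits.\<close>

lemma super_at_stable:
  assumes a: "continuous_on UNIV a" and H: "continuous_on UNIV (\<lambda>(x, p). H x p)"
    and \<delta>: "0 < \<delta>"
    and approx: "\<And>e. 0 < e \<Longrightarrow> \<exists>u. continuous_on UNIV u \<and> u x \<le> w x + e \<and>
        (\<forall>z. \<bar>z - x\<bar> < \<delta> \<longrightarrow> w z - e \<le> u z \<and> super_at a H (l + e) u z)"
  shows "super_at a H l w x"
  unfolding super_at_def
proof (intro allI impI)
  fix p q assume "below_jet w x p q"
  then obtain \<rho> where \<rho>: "\<rho> > 0"
    and below: "\<And>z. \<bar>z - x\<bar> < \<rho> \<Longrightarrow> w x + p * (z - x) + q * (z - x)\<^sup>2 \<le> w z"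
    unfolding below_jet_def by auto
  \<comment> \<open>Opening the parabola downwards by \<open>\<eta>\<close> makes the contact with
    \<open>w\<close> strict: the gap is at least \<open>\<eta> * (z - x)\<^sup>2\<close>. Hence a
    nearby function also has a contact point, close to \<open>x\<close>.\<close>
  have perturbed: "a x * (2 * (q - \<eta>)) + H x p \<le> l" if \<eta>: "\<eta> > 0" for \<eta>
  proof -
    define F where "F z = a z * (2 * (q - \<eta>)) + H z (p + 2 * (q - \<eta>) * (z - x))" for z
    have near: "\<exists>z. \<bar>z - x\<bar> < r \<and> F z \<le> l + r" if r: "0 < r" "r < \<delta>" "r < \<rho>" for r
    proof -
      \<comment> \<open>At a minimum point of \<open>g\<close> the gap
        \<open>\<eta> * (z - x)\<^sup>2\<close> is at most \<open>2 * e\<close>, while on the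
        boundary \<open>\<bar>z - x\<bar> = r\<close> it equals \<open>\<eta> * r\<^sup>2\<close>.
        The factor 1/3 forces the minimum into the interior; \<open>e \<le> r\<close> lets the error
        in the level vanish with \<open>r\<close>.\<close>
      define e where "e = min r (\<eta> * r\<^sup>2 / 3)"
      have e: "e > 0" "2 * e < \<eta> * r\<^sup>2" "e \<le> r"
        using r \<eta> by (auto simp: e_def min_def)
      obtain u where cu: "continuous_on UNIV u" and ux: "u x \<le> w x + e"
        and ul: "\<And>z. \<bar>z - x\<bar> < \<delta> \<Longrightarrow> w z - e \<le> u z"
        and us: "\<And>z. \<bar>z - x\<bar> < \<delta> \<Longrightarrow> super_at a H (l + e) u z"
        using approx[OF e(1)] by auto
      define g where "g z = u z - (w x + p * (z - x) + (q - \<eta>) * (z - x)\<^sup>2)" for z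
      have "continuous_on {x - r..x + r} g"
        unfolding g_def by (intro continuous_intros continuous_on_subset[OF cu]) auto
      from continuous_attains_inf[OF _ _ this]
      obtain z where z: "z \<in> {x - r..x + r}" and min: "\<And>y. y \<in> {x - r..x + r} \<Longrightarrow> g z \<le> g y"
        using r by auto
      have gz: "\<eta> * (z - x)\<^sup>2 - e \<le> g z"
      proof -
        have "\<bar>z - x\<bar> < \<rho>" "\<bar>z - x\<bar> < \<delta>" using z r by auto
        from below[OF this(1)] ul[OF this(2)] show ?thesis
          by (simp add: g_def algebra_simps)
      qed
      have "g z \<le> e" using min[of x] r ux by (simp add: g_def)
      then have "\<eta> * (z - x)\<^sup>2 < \<eta> * r\<^sup>2" using gz e by linarith
      then have zr: "\<bar>z - x\<bar> < r"
        using \<eta> r by (simp add: abs_le_square_iff power2_less_imp_less real_less_rsqrt flip: not_le)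
          (metis abs_le_square_iff abs_of_pos not_le)
      have "below_jet u z (p + 2 * (q - \<eta>) * (z - x)) (q - \<eta>)"
        unfolding below_jet_def
      proof (intro exI[of _ "r - \<bar>z - x\<bar>"] conjI allI impI)
        fix y assume "\<bar>y - z\<bar> < r - \<bar>z - x\<bar>"
        then have "g z \<le> g y" by (intro min) auto
        then show "u z + (p + 2 * (q - \<eta>) * (z - x)) * (y - z) + (q - \<eta>) * (y - z)\<^sup>2 \<le> u y"
          by (simp add: g_def algebra_simps power2_eq_square)
      qed (use zr in auto)
      from super_atD[OF us this] have "F z \<le> l + e"
        using zr r by (simp add: F_def)
      with zr e show ?thesis by (intro exI[of _ z]) auto
    qed
    have "continuous_on UNIV F"
      unfolding F_def
      by (intro continuous_intros a continuous_on_compose2[OF H, where f = "\<lambda>z. (z, _ z)", simplified])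
    then have F: "isCont F x" by (simp add: continuous_on_eq_continuous_at)
    have "F x \<le> l"
    proof (rule field_le_epsilon)
      fix e :: real assume e: "e > 0"
      obtain d where d: "d > 0" "\<And>z. \<bar>z - x\<bar> < d \<Longrightarrow> \<bar>F z - F x\<bar> < e / 2"
        using F e unfolding continuous_at_eps_delta dist_real_def
        by (metis half_gt_zero)
      define r where "r = min (min (\<delta> / 2) (\<rho> / 2)) (min d (e / 2))"
      have "0 < r" "r < \<delta>" "r < \<rho>" "r \<le> d" "r \<le> e / 2"
        using d e \<delta> \<rho> by (auto simp: r_def)
      with near[of r] d(2) show "F x \<le> l + e"
        by (smt (verit) field_sum_of_halves)
    qed
    then show ?thesis by (simp add: F_def)
  qed
  show "a x * (2 * q) + H x p \<le> l"
  proof (rule tendsto_upperbound)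
    show "((\<lambda>e. a x * (2 * (q - e)) + H x p) \<longlongrightarrow> a x * (2 * q) + H x p) (at_right 0)"
      by (auto intro!: tendsto_eq_intros)
    show "\<forall>\<^sub>F e in at_right 0. a x * (2 * (q - e)) + H x p \<le> l"
      using perturbed eventually_at_right_less by (rule eventually_mono[rotated])
  qed simp
qed

text \<open>Arzela-Ascoli on the whole line: a diagonal choice gives convergence on the rationals,
  the common Lipschitz constant extends it to every real, and a finite net of a compact interval
  makes it uniform there.\<close>

lemma lipschitz_subsequence:
  fixes f :: "nat \<Rightarrow> real \<Rightarrow> real"
  assumes lip: "\<And>n. K-lipschitz_on UNIV (f n)" and f0: "\<And>n. f n 0 = 0"
  obtains k u where "strict_mono k" "K-lipschitz_on UNIV u"
    "\<And>R e. 0 < e \<Longrightarrow> \<forall>\<^sub>F n in sequentially. \<forall>x. \<bar>x\<bar> \<le> R \<longrightarrow> \<bar>f (k n) x - u x\<bar> < e"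
proof -
  have K: "\<bar>f n x - f n y\<bar> \<le> K * \<bar>x - y\<bar>" for n x y
    using lipschitz_onD[OF lip, of x y n] by (auto simp: dist_real_def)
  have K0: "0 \<le> K" using lip lipschitz_on_nonneg by blast
  \<comment> \<open>The diagonal lemma expects one bound valid at all points. As \<open>f n\<close>
    grows at most like \<open>K * \<bar>x\<bar>\<close>, division by
    \<open>1 + \<bar>x\<bar>\<close> provides it without affecting pointwise convergence.\<close>
  have bound: "norm (f n x / (1 + \<bar>x\<bar>)) \<le> K" for n x
  proof -
    have "\<bar>f n x\<bar> \<le> K * (1 + \<bar>x\<bar>)" using K[of n x 0] f0[of n] K0 by (simp add: algebra_simps)
    then show ?thesis by (simp add: field_simps)
  qed
  obtain k where k: "strict_mono k"
    and conv: "\<And>x. x \<in> \<rat> \<Longrightarrow> \<exists>l. (\<lambda>n. f (k n) x / (1 + \<bar>x\<bar>)) \<longlonglongrightarrow> l"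
    using function_convergent_subsequence[of "\<rat>" "\<lambda>n x. f n x / (1 + \<bar>x\<bar>)" K] bound countable_rat
    by metis
  have conv_rat: "Cauchy (\<lambda>n. f (k n) x)" if x: "x \<in> \<rat>" for x
  proof -
    obtain l where "(\<lambda>n. f (k n) x / (1 + \<bar>x\<bar>)) \<longlonglongrightarrow> l" using conv[OF x] by auto
    then have "(\<lambda>n. f (k n) x / (1 + \<bar>x\<bar>) * (1 + \<bar>x\<bar>)) \<longlonglongrightarrow> l * (1 + \<bar>x\<bar>)"
      by (intro tendsto_intros)
    then show ?thesis by (simp add: LIMSEQ_imp_Cauchy)
  qed
  have near_rat: "\<exists>y\<in>\<rat>. \<bar>x - y\<bar> < d" if d: "d > 0" for x d :: real
  proof -
    obtain y where "y \<in> \<rat>" "x < y" "y < x + d" using Rats_dense_in_real[of x "x + d"] d by auto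
    then show ?thesis by (intro bexI[of _ y]) auto
  qed
  have "convergent (\<lambda>n. f (k n) x)" for x
  proof -
    have "Cauchy (\<lambda>n. f (k n) x)"
    proof (rule metric_CauchyI)
      fix e :: real assume e: "e > 0"
      obtain y where y: "y \<in> \<rat>" "\<bar>x - y\<bar> < e / (3 * (K + 1))"
        using near_rat[of "e / (3 * (K + 1))"] e K0 by auto
      have Ky: "K * \<bar>x - y\<bar> \<le> e / 3"
      proof -
        have "K * \<bar>x - y\<bar> \<le> (K + 1) * (e / (3 * (K + 1)))"
          using y K0 by (intro mult_mono) auto
        also have "\<dots> = e / 3" using K0 by (simp add: field_simps)
        finally show ?thesis .
      qed
      obtain M where M: "\<And>m n. m \<ge> M \<Longrightarrow> n \<ge> M \<Longrightarrow> \<bar>f (k m) y - f (k n) y\<bar> < e / 3"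
        using metric_CauchyD[OF conv_rat[OF y(1)], of "e / 3"] e by (auto simp: dist_real_def)
      have "\<bar>f (k m) x - f (k n) x\<bar> < e" if "m \<ge> M" "n \<ge> M" for m n
        using M[OF that] K[of "k m" x y] K[of "k n" x y] Ky by linarith
      then show "\<exists>M. \<forall>m\<ge>M. \<forall>n\<ge>M. dist (f (k m) x) (f (k n) x) < e"
        by (auto simp: dist_real_def)
    qed
    then show ?thesis by (rule Cauchy_convergent)
  qed
  then obtain u where u: "\<And>x. (\<lambda>n. f (k n) x) \<longlonglongrightarrow> u x"
    unfolding convergent_def by metis
  have Ku: "\<bar>u x - u y\<bar> \<le> K * \<bar>x - y\<bar>" for x y
    by (rule tendsto_upperbound[OF tendsto_rabs[OF tendsto_diff[OF u u]]]) (simp_all add: K)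
  have unif: "\<forall>\<^sub>F n in sequentially. \<forall>x. \<bar>x\<bar> \<le> R \<longrightarrow> \<bar>f (k n) x - u x\<bar> < e" if e: "e > 0" for R e
  proof -
    define d where "d = e / (3 * (K + 1))"
    have d: "d > 0" "K * d \<le> e / 3"
      using e K0 by (auto simp: d_def field_simps)
    have "compact {- R..R}" by simp
    then obtain T where T: "finite T" "{- R..R} \<subseteq> (\<Union>t\<in>T. ball t d)"
      using compact_eq_totally_bounded[of "{- R..R}"] d(1) by blast
    have "\<forall>\<^sub>F n in sequentially. \<forall>t\<in>T. \<bar>f (k n) t - u t\<bar> < e / 3"
      using T(1) tendstoD[OF u, of "e / 3"] e by (simp add: eventually_ball_finite dist_real_def)
    then show ?thesis
    proof (rule eventually_mono, intro allI impI)
      fix n x assume n: "\<forall>t\<in>T. \<bar>f (k n) t - u t\<bar> < e / 3" and "\<bar>x\<bar> \<le> R"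
      then have "x \<in> {- R..R}" by auto
      then obtain t where t: "t \<in> T" "\<bar>x - t\<bar> < d" using T by (auto simp: dist_real_def abs_minus_commute)
      have "K * \<bar>x - t\<bar> \<le> e / 3" using t d K0 by (smt (verit) mult_left_mono)
      moreover have "\<bar>f (k n) t - u t\<bar> < e / 3" using n t by blast
      ultimately show "\<bar>f (k n) x - u x\<bar> < e" using K[of "k n" x t] Ku[of x t] by linarith
    qed
  qed
  show ?thesis
    by (rule that[OF k _ unif]) (auto intro!: lipschitz_onI Ku K0 simp: dist_real_def)
qed


section \<open>Lipschitz bound for supersolutions\<close>

text \<open>The barrier \<open>c R ln (1 - (z - y) / R)\<close> is a strict subsolution on \<open>(y, y + R)\<close>, because
  its second derivative grows like the square of its first and \<open>\<gamma> > 2\<close>. It tends to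
  \<open>-\<infinity>\<close> at \<open>y + R\<close>, so no boundary information on \<open>u\<close> is needed, and in dimension one
  the vertex \<open>y\<close> carries no further second order term.\<close>

lemma super_lower_bound_right:
  assumes cont: "continuous_on UNIV u" and super: "\<And>x. super_at a H l u x"
    and a: "\<And>x. 0 \<le> a x" "\<And>x. a x \<le> 1"
    and H: "\<And>x p. \<alpha>0 * \<bar>p\<bar> powr \<gamma> - 1 / \<alpha>0 \<le> H x p"
    and pos: "0 < \<alpha>0" "2 < \<gamma>"
    and c: "1 \<le> c" "1 \<le> \<alpha>0 * c" "l < \<alpha>0 * c\<^sup>2 - c - 1 / \<alpha>0"
    and yx: "y < x"
  shows "u y - 2 * c * (x - y) \<le> u x"
proof (rule ccontr)
  assume "\<not> u y - 2 * c * (x - y) \<le> u x"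
  then have low: "u x < u y - 2 * c * (x - y)" by simp
  \<comment> \<open>This length puts \<open>x\<close> in the first half of the interval, so
    \<open>m x\<close> is at least 1/2 and the logarithm costs at most twice its linearisation; that
    is the factor 2 in the slope \<open>2 * c\<close>. The summand 1 gives \<open>R \<ge> 1\<close>,
    which keeps the curvature factor \<open>c / R\<close> below \<open>c\<close>.\<close>
  define R where "R = 1 + 2 * (x - y)"
  have R: "1 \<le> R" "x - y < R / 2" using yx by (auto simp: R_def)
  define m where "m z = 1 - (z - y) / R" for z
  define g where "g z = u z - u y - c * R * ln (m z)" for z
  have mpos: "0 < m z" if "z < y + R" for z
    using that R by (simp add: m_def field_simps)
  have mx: "1 / 2 \<le> m x" using R by (simp add: m_def field_simps)
  have "ln (1 / m x) \<le> 1 / m x - 1" using mx by (intro ln_le_minus_one) auto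
  then have "- ln (m x) \<le> (1 - m x) / m x" using mx by (simp add: ln_div field_simps)
  also have "\<dots> \<le> (1 - m x) / (1 / 2)"
    using mx yx R by (intro divide_left_mono) (auto simp: m_def)
  also have "\<dots> = 2 * (x - y) / R" by (simp add: m_def)
  finally have "c * R * (- ln (m x)) \<le> c * R * (2 * (x - y) / R)"
    using c R by (intro mult_left_mono) auto
  moreover have "c * R * (2 * (x - y) / R) = 2 * c * (x - y)" using R by simp
  ultimately have gx: "g x < 0" using low unfolding g_def by linarith
  have "continuous_on {y..y + R} u" using cont by (rule continuous_on_subset) auto
  from continuous_attains_inf[OF _ _ this] obtain b
    where b: "\<And>z. z \<in> {y..y + R} \<Longrightarrow> u b \<le> u z" using R by force
  \<comment> \<open>The barrier has to be cut off before its singularity. The exponential is chosen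
    so that where \<open>m\<close> equals \<open>e\<close> the barrier has dropped below the minimum
    of \<open>u - u y\<close> by the margin \<open>c * R\<close>; the bound 1/2 keeps the cut-off
    point \<open>s\<close> to the right of \<open>x\<close>.\<close>
  define e where "e = min (1 / 2) (exp ((u b - u y) / (c * R) - 1))"
  have e: "0 < e" "e \<le> 1 / 2" by (auto simp: e_def)
  have "ln e \<le> ln (exp ((u b - u y) / (c * R) - 1))"
    using e(1) by (intro ln_mono) (auto simp: e_def)
  then have "c * R * ln e \<le> c * R * ((u b - u y) / (c * R) - 1)"
    using c R by (intro mult_left_mono) auto
  also have "\<dots> = u b - u y - c * R" using c R by (simp add: field_simps)
  also have "\<dots> < u b - u y" using c R by (simp add: zero_less_mult_iff)
  finally have lne: "c * R * ln e < u b - u y" .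
  define s where "s = y + R * (1 - e)"
  have s: "x < s" "s < y + R" "m s = e"
  proof -
    have "R * e \<le> R * (1 / 2)" using e R by (intro mult_left_mono) auto
    then show "x < s" using R unfolding s_def right_diff_distrib by linarith
    show "s < y + R" using e R by (simp add: s_def algebra_simps)
    show "m s = e" using R by (simp add: m_def s_def)
  qed
  have gs: "0 < g s"
    using b[of s] lne s yx by (simp add: g_def)
  have gy: "g y = 0" by (simp add: g_def m_def)
  have "continuous_on {y..s} g"
    unfolding g_def m_def
    by (intro continuous_intros continuous_on_subset[OF cont])
      (use mpos s R in \<open>auto simp: m_def less_le\<close>)
  from continuous_attains_inf[OF _ _ this] obtain z
    where z: "z \<in> {y..s}" and min: "\<And>v. v \<in> {y..s} \<Longrightarrow> g z \<le> g v" using yx s by auto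
  \<comment> \<open>The values of \<open>g\<close> at \<open>y\<close>, \<open>x\<close> and
    \<open>s\<close> are zero, negative and positive, so the minimum is interior and the raised
    barrier touches \<open>u\<close> from below there.\<close>
  have "g z < 0" using min[of x] gx yx s by auto
  then have zys: "y < z" "z < s" using z gs gy by (auto simp: less_le)
  define k where "k = 1 / m z"
  have mz: "0 < m z" "m z \<le> 1" using mpos[of z] zys s R by (auto simp: m_def)
  then have k: "1 \<le> k" by (simp add: k_def)
  have "a z * (- (c / R) * k\<^sup>2) + H z (- c / m z) \<le> l"
  proof (rule super_at_touching[OF super, of "min (z - y) (s - z)" z
        "\<lambda>v. u y + c * R * ln (m v) + g z" "\<lambda>v. - c / m v"])
    fix v assume v: "\<bar>v - z\<bar> < min (z - y) (s - z)"
    then have vs: "v \<in> {y..s}" by auto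
    have mv: "0 < m v" using v s by (intro mpos) auto
    have m': "(m has_real_derivative - 1 / R) (at v)"
      unfolding m_def using R by (auto intro!: derivative_eq_intros)
    show "((\<lambda>v. u y + c * R * ln (m v) + g z) has_real_derivative - c / m v) (at v)"
      using mv R by (auto intro!: derivative_eq_intros m')
    show "u y + c * R * ln (m v) + g z \<le> u v"
      using min[OF vs] by (simp add: g_def)
  next
    have m': "(m has_real_derivative - 1 / R) (at z)"
      unfolding m_def using R by (auto intro!: derivative_eq_intros)
    show "((\<lambda>v. - c / m v) has_real_derivative - (c / R) * k\<^sup>2) (at z)"
      using mz R by (auto intro!: derivative_eq_intros m' simp: k_def power2_eq_square)
  qed (use zys in \<open>auto simp: g_def\<close>)
  \<comment> \<open>Because \<open>c * k \<ge> 1\<close>, the power \<open>\<gamma>\<close>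
    dominates the square, and the square is what the curvature term \<open>c * k\<^sup>2\<close>
    must be compared with. The contact inequality becomes \<open>(\<alpha>0 * c\<^sup>2 - c) *
    k\<^sup>2 - 1 / \<alpha>0 \<le> l\<close>. Its bracket is nonnegative and
    \<open>k \<ge> 1\<close>, which contradicts the choice of \<open>c\<close>.\<close>
  moreover have "H z (- c / m z) \<ge> \<alpha>0 * (c\<^sup>2 * k\<^sup>2) - 1 / \<alpha>0"
  proof -
    have ck: "1 \<le> c * k" using mult_mono[of 1 c 1 k] c k by simp
    have "(c * k)\<^sup>2 = (c * k) powr 2" using ck by simp
    also have "\<dots> \<le> (c * k) powr \<gamma>" using ck pos by (intro powr_mono) auto
    finally have "\<alpha>0 * (c\<^sup>2 * k\<^sup>2) \<le> \<alpha>0 * (c * k) powr \<gamma>"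
      using pos by (simp add: power_mult_distrib)
    moreover have "\<bar>- c / m z\<bar> = c * k" using c mz by (simp add: k_def)
    ultimately show ?thesis using H[of "- c / m z" z] by (auto intro: order_trans[rotated])
  qed
  moreover have "a z * (- (c / R) * k\<^sup>2) \<ge> - (c * k\<^sup>2)"
  proof -
    have "c / R \<le> c" using R c by (simp add: divide_le_eq mult_le_cancel_left1)
    then have "a z * (c / R * k\<^sup>2) \<le> 1 * (c * k\<^sup>2)"
      using a[of z] c R by (intro mult_mono mult_right_mono) auto
    then show ?thesis by simp
  qed
  moreover have "\<alpha>0 * c\<^sup>2 - c \<le> (\<alpha>0 * c\<^sup>2 - c) * k\<^sup>2"
  proof -
    have "0 \<le> c * (\<alpha>0 * c - 1)" using c by auto
    then have "0 \<le> \<alpha>0 * c\<^sup>2 - c" by (simp add: algebra_simps power2_eq_square)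
    moreover have "1 \<le> k\<^sup>2" using k by (simp add: one_le_power)
    ultimately show ?thesis by (simp add: mult_le_cancel_left1)
  qed
  ultimately show False using c(3) by (simp add: algebra_simps)
qed

lemma super_at_reflect:
  assumes "super_at a H l u (- x)"
  shows "super_at (\<lambda>x. a (- x)) (\<lambda>x p. H (- x) (- p)) l (\<lambda>x. u (- x)) x"
  unfolding super_at_def
proof (intro allI impI)
  fix p q assume "below_jet (\<lambda>x. u (- x)) x p q"
  then obtain \<delta> where \<delta>: "\<delta> > 0"
    "\<And>z. \<bar>z - x\<bar> < \<delta> \<Longrightarrow> u (- x) + p * (z - x) + q * (z - x)\<^sup>2 \<le> u (- z)"
    unfolding below_jet_def by auto
  have "below_jet u (- x) (- p) q"
    unfolding below_jet_def
  proof (intro exI[of _ \<delta>] conjI allI impI \<delta>(1))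
    fix z assume "\<bar>z - - x\<bar> < \<delta>"
    then show "u (- x) + - p * (z - - x) + q * (z - - x)\<^sup>2 \<le> u z"
      using \<delta>(2)[of "- z"] by (simp add: algebra_simps power2_eq_square abs_minus_commute)
  qed
  from super_atD[OF assms this] show "a (- x) * (2 * q) + H (- x) (- p) \<le> l" .
qed

text \<open>Twice the barrier slope \<open>c\<close>, where \<open>c\<close> is at least 1 and so
  large that \<open>\<alpha>0 * c \<ge> \<bar>l\<bar> + 1 / \<alpha>0 + 2\<close>. Then
  \<open>c * (\<alpha>0 * c - 1)\<close> exceeds \<open>l + 1 / \<alpha>0\<close>, as the barrier
  requires.\<close>

definition grad_bound :: "real \<Rightarrow> real \<Rightarrow> real" where
  "grad_bound \<alpha>0 l = 2 * (1 + (\<bar>l\<bar> + 1 / \<alpha>0 + 2) / \<alpha>0)"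

lemma super_lipschitz:
  assumes super: "visc_super a H l u"
    and a: "\<And>x. 0 \<le> a x" "\<And>x. a x \<le> 1"
    and H: "\<And>x p. \<alpha>0 * \<bar>p\<bar> powr \<gamma> - 1 / \<alpha>0 \<le> H x p"
    and pos: "0 < \<alpha>0" "2 < \<gamma>"
  shows "(grad_bound \<alpha>0 l)-lipschitz_on UNIV u"
proof -
  define c where "c = 1 + (\<bar>l\<bar> + 1 / \<alpha>0 + 2) / \<alpha>0"
  have c1: "1 \<le> c" using pos by (simp add: c_def)
  have "\<alpha>0 * c = \<alpha>0 + (\<bar>l\<bar> + 1 / \<alpha>0 + 2)"
    unfolding c_def distrib_left using pos by (simp del: distrib_left)
  then have c2: "\<bar>l\<bar> + 1 / \<alpha>0 + 2 \<le> \<alpha>0 * c" using pos by linarith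
  have ia: "0 < 1 / \<alpha>0" using pos by simp
  have c4: "1 \<le> \<alpha>0 * c" using c2 ia abs_ge_zero[of l] by linarith
  have "1 * (\<alpha>0 * c - 1) \<le> c * (\<alpha>0 * c - 1)"
    using c1 c4 by (intro mult_right_mono) auto
  then have c3: "l < \<alpha>0 * c\<^sup>2 - c - 1 / \<alpha>0"
    using c2 by (simp add: algebra_simps power2_eq_square)
  have cont: "continuous_on UNIV u" and sup: "\<And>x. super_at a H l u x"
    using super by (auto simp: visc_super_iff)
  have right: "u y - 2 * c * (x - y) \<le> u x" if "y < x" for x y
    by (rule super_lower_bound_right[OF cont sup a H pos c1 c4 c3 that])
  have left: "u y - 2 * c * (y - x) \<le> u x" if "x < y" for x y
  proof -
    have "continuous_on UNIV (\<lambda>x. u (- x))"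
      by (intro continuous_on_compose2[OF cont] continuous_intros) auto
    from super_lower_bound_right[OF this super_at_reflect[OF sup], of \<alpha>0 \<gamma> c "- y" "- x"]
    show ?thesis using that a pos c1 c4 c3 H[of "- _"] by auto
  qed
  have gb: "grad_bound \<alpha>0 l = 2 * c" by (simp add: grad_bound_def c_def)
  show ?thesis
    unfolding gb
  proof (rule lipschitz_onI)
    fix x y
    show "dist (u x) (u y) \<le> 2 * c * dist x y"
      using right[of x y] right[of y x] left[of x y] left[of y x]
      by (cases x y rule: linorder_cases) (auto simp: dist_real_def)
  qed (use c1 in auto)
qed

section \<open>Regularity from two-sided bounds on the second derivative\<close>

text \<open>If the convexity inequality failed, the chord minus the function would have a negative
  interior minimum. Written in terms of \<open>u\<close>, that minimum is a contact from below with
  a parabola whose second derivative is exactly \<open>M\<close>. Strictness in the hypothesis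
  excludes it without any perturbation.\<close>

lemma semiconcave:
  assumes cont: "continuous_on UNIV u"
    and test: "\<And>z p q. z \<in> {l<..<r} \<Longrightarrow> below_jet u z p q \<Longrightarrow> 2 * q < M"
  shows "convex_on {l..r} (\<lambda>z. M / 2 * z\<^sup>2 - u z)"
proof (rule convex_on_linorderI)
  fix t x y :: real
  assume t: "0 < t" "t < 1" and xy: "x \<in> {l..r}" "y \<in> {l..r}" "x < y"
  define f where "f z = M / 2 * z\<^sup>2 - u z" for z
  define s where "s = (f y - f x) / (y - x)"
  define g where "g z = f x + s * (z - x) - f z" for z
  have "continuous_on {x..y} g"
    unfolding g_def f_def by (intro continuous_intros continuous_on_subset[OF cont]) auto
  from continuous_attains_inf[OF _ _ this] obtain z
    where z: "z \<in> {x..y}" and min: "\<And>v. v \<in> {x..y} \<Longrightarrow> g z \<le> g v" using xy by auto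
  have ends: "g x = 0" "g y = 0" using xy by (auto simp: g_def s_def)
  have "0 \<le> g z"
  proof (rule ccontr)
    assume "\<not> 0 \<le> g z"
    then have z': "x < z" "z < y" using z ends by (auto simp: less_le)
    have "below_jet u z (M * z - s) (M / 2)"
      unfolding below_jet_def
    proof (intro exI[of _ "min (z - x) (y - z)"] conjI allI impI)
      fix v assume "\<bar>v - z\<bar> < min (z - x) (y - z)"
      then have "g z \<le> g v" by (intro min) auto
      then show "u z + (M * z - s) * (v - z) + M / 2 * (v - z)\<^sup>2 \<le> u v"
        by (simp add: g_def f_def field_simps power2_eq_square)
    qed (use z' in auto)
    from test[OF _ this] show False using z' xy by auto
  qed
  moreover have "(1 - t) * x + t * y \<in> {x..y}"
  proof -
    have "0 \<le> t * (y - x)" "t * (y - x) \<le> 1 * (y - x)" using t xy by (auto intro!: mult_right_mono)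
    then show ?thesis by (auto simp: algebra_simps)
  qed
  ultimately have "0 \<le> g ((1 - t) * x + t * y)" using min by force
  moreover have "s * ((1 - t) * x + t * y - x) = t * (f y - f x)"
  proof -
    have "s * ((1 - t) * x + t * y - x) = t * (s * (y - x))" by (simp add: algebra_simps)
    then show ?thesis using xy by (simp add: s_def)
  qed
  ultimately show "M / 2 * ((1 - t) *\<^sub>R x + t *\<^sub>R y)\<^sup>2 - u ((1 - t) *\<^sub>R x + t *\<^sub>R y)
      \<le> (1 - t) * (M / 2 * x\<^sup>2 - u x) + t * (M / 2 * y\<^sup>2 - u y)"
    unfolding f_def[symmetric] by (simp add: g_def algebra_simps)
qed simp

text \<open>A supporting line of the convex function in \<open>semiconcave\<close>, translated back
  to \<open>u\<close>, is a parabola above \<open>u\<close> that meets it at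
  \<open>x\<close>.\<close>

lemma semiconcave_tangent:
  assumes "continuous_on UNIV u"
    and "\<And>z p q. z \<in> {l<..<r} \<Longrightarrow> below_jet u z p q \<Longrightarrow> 2 * q < M"
    and x: "x \<in> {l<..<r}"
  shows "\<exists>d. \<forall>z\<in>{l..r}. u z \<le> u x + d * (z - x) + M / 2 * (z - x)\<^sup>2"
proof -
  define f where "f z = M / 2 * z\<^sup>2 - u z" for z
  have "convex_on {l..r} f"
    unfolding f_def by (rule semiconcave[OF assms(1,2)])
  from convex_le_Inf_differential[OF this] x
  obtain s where s: "\<And>z. z \<in> {l..r} \<Longrightarrow> f x + s * (z - x) \<le> f z"
    by fastforce
  have "u z \<le> u x + (M * x - s) * (z - x) + M / 2 * (z - x)\<^sup>2" if "z \<in> {l..r}" for z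
    using s[OF that] by (simp add: f_def field_simps power2_eq_square)
  then show ?thesis by blast
qed

text \<open>At each point \<open>u\<close> lies between two parabolas through its graph; their
  slopes must coincide, and this common slope is the derivative. The bounds \<open>M\<close> and
  \<open>N\<close> are kept independent because the lemma serves twice: with a crude symmetric pair
  to obtain a continuous \<open>u'\<close>, and with a nearly equal pair to identify
  \<open>u''\<close>.\<close>

lemma deriv_bounds:
  assumes cont: "continuous_on UNIV u"
    and up: "\<And>z p q. z \<in> {l<..<r} \<Longrightarrow> below_jet u z p q \<Longrightarrow> 2 * q < M"
    and lo: "\<And>z p q. z \<in> {l<..<r} \<Longrightarrow> below_jet (\<lambda>z. - u z) z p q \<Longrightarrow> 2 * q < - N"
  shows "\<And>z. z \<in> {l<..<r} \<Longrightarrow> (u has_real_derivative deriv u z) (at z)"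
    and "\<And>x y. \<lbrakk>x \<in> {l<..<r}; y \<in> {l<..<r}; x < y\<rbrakk> \<Longrightarrow>
      N * (y - x) \<le> deriv u y - deriv u x \<and> deriv u y - deriv u x \<le> M * (y - x)"
proof -
  have ex: "\<exists>d. \<forall>z\<in>{l..r}. u x + d * (z - x) + N / 2 * (z - x)\<^sup>2 \<le> u z \<and>
      u z \<le> u x + d * (z - x) + M / 2 * (z - x)\<^sup>2" if x: "x \<in> {l<..<r}" for x
  proof -
    obtain d where d: "\<And>z. z \<in> {l..r} \<Longrightarrow> u z \<le> u x + d * (z - x) + M / 2 * (z - x)\<^sup>2"
      using semiconcave_tangent[of u l r M x, OF cont _ x] up by blast
    have "continuous_on UNIV (\<lambda>z. - u z)" by (intro continuous_intros cont)
    from semiconcave_tangent[of _ l r "- N" x, OF this _ x] lo obtain e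
      where e: "\<And>z. z \<in> {l..r} \<Longrightarrow> - u z \<le> - u x + e * (z - x) + - N / 2 * (z - x)\<^sup>2" by blast
    have "0 \<le> (d + e) * h + (M / 2 - N / 2) * h\<^sup>2" if "\<bar>h\<bar> < min (x - l) (r - x)" for h
    proof -
      have "x + h \<in> {l..r}" using that by auto
      from d[OF this] e[OF this] show ?thesis by (simp add: algebra_simps)
    qed
    then have "d + e = 0"
      using x by (intro linear_plus_square_nonneg(1)[of "min (x - l) (r - x)" "d + e" "M / 2 - N / 2"]) auto
    then have "e = - d" by simp
    with d e show ?thesis by (intro exI[of _ d]) (force simp: algebra_simps)
  qed
  define D where "D x = (SOME d. \<forall>z\<in>{l..r}. u x + d * (z - x) + N / 2 * (z - x)\<^sup>2 \<le> u z \<and>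
      u z \<le> u x + d * (z - x) + M / 2 * (z - x)\<^sup>2)" for x
  have D: "u x + D x * (z - x) + N / 2 * (z - x)\<^sup>2 \<le> u z"
    "u z \<le> u x + D x * (z - x) + M / 2 * (z - x)\<^sup>2" if "x \<in> {l<..<r}" "z \<in> {l..r}" for x z
    using someI_ex[OF ex[OF that(1)]] that(2) unfolding D_def by auto
  have der: "(u has_real_derivative D x) (at x)" if x: "x \<in> {l<..<r}" for x
  proof -
    define C where "C = \<bar>M\<bar> + \<bar>N\<bar>"
    have bound: "\<bar>(u z - u x) / (z - x) - D x\<bar> \<le> C * \<bar>z - x\<bar>" if z: "z \<in> {l..r}" "z \<noteq> x" for z
    proof -
      have "M / 2 * (z - x)\<^sup>2 \<le> C * (z - x)\<^sup>2" "- N / 2 * (z - x)\<^sup>2 \<le> C * (z - x)\<^sup>2"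
        by (intro mult_right_mono; simp add: C_def)+
      then have "\<bar>u z - u x - D x * (z - x)\<bar> \<le> C * (z - x)\<^sup>2"
        using D[OF x z(1)] by (auto simp: abs_le_iff)
      also have "u z - u x - D x * (z - x) = ((u z - u x) / (z - x) - D x) * (z - x)"
        using z by (simp add: field_simps)
      also have "C * (z - x)\<^sup>2 = (C * \<bar>z - x\<bar>) * \<bar>z - x\<bar>"
        by (simp add: power2_eq_square)
      finally show ?thesis using z by (simp add: abs_mult)
    qed
    have "(\<lambda>z. (u z - u x) / (z - x) - D x) \<midarrow>x\<rightarrow> 0"
    proof (rule Lim_null_comparison)
      have "\<forall>\<^sub>F z in at x. z \<in> {l<..<r}" using x by (intro eventually_at_in_open') auto
      moreover have "\<forall>\<^sub>F z in at x. z \<noteq> x" by (simp add: eventually_at_filter)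
      ultimately show "\<forall>\<^sub>F z in at x. norm ((u z - u x) / (z - x) - D x) \<le> C * \<bar>z - x\<bar>"
        by eventually_elim (use bound in auto)
      show "(\<lambda>z. C * \<bar>z - x\<bar>) \<midarrow>x\<rightarrow> 0" by (auto intro!: tendsto_eq_intros)
    qed
    then show ?thesis unfolding has_field_derivative_iff by (simp add: LIM_zero_iff)
  qed
  then have eq: "deriv u x = D x" if "x \<in> {l<..<r}" for x
    using that by (intro DERIV_imp_deriv)
  show "(u has_real_derivative deriv u z) (at z)" if "z \<in> {l<..<r}" for z
    using der[OF that] eq[OF that] by simp
  fix x y assume x: "x \<in> {l<..<r}" and y: "y \<in> {l<..<r}" and xy: "x < y"
  have mem: "x \<in> {l..r}" "y \<in> {l..r}" using x y by auto
  \<comment> \<open>The parabola at \<open>x\<close> evaluated at \<open>y\<close> is added to the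
    parabola at \<open>y\<close> evaluated at \<open>x\<close>; the values of \<open>u\<close>
    cancel and a common factor \<open>y - x\<close> remains.\<close>
  have "(y - x) * (N * (y - x)) \<le> (y - x) * (D y - D x)"
    using D(1)[OF x mem(2)] D(1)[OF y mem(1)] by (simp add: algebra_simps power2_eq_square)
  moreover have "(y - x) * (D y - D x) \<le> (y - x) * (M * (y - x))"
    using D(2)[OF x mem(2)] D(2)[OF y mem(1)] by (simp add: algebra_simps power2_eq_square)
  ultimately show "N * (y - x) \<le> deriv u y - deriv u x \<and> deriv u y - deriv u x \<le> M * (y - x)"
    using xy by (simp add: eq[OF x] eq[OF y])
qed


section \<open>The equation\<close>

locale viscous_HJ =
  fixes a :: "real \<Rightarrow> real" and H :: "real \<Rightarrow> real \<Rightarrow> real" and \<alpha>0 \<alpha>1 \<gamma> :: real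
  assumes \<alpha>0_pos: "0 < \<alpha>0" and \<gamma>_gt_2: "2 < \<gamma>"
    and a_nonneg: "0 \<le> a x" and a_le_1: "a x \<le> 1" and a_cont: "continuous_on UNIV a"
    and H_class: "Hclass \<alpha>0 \<alpha>1 \<gamma> H"
begin

lemmas H_lower = H_class[unfolded Hclass_def, THEN conjunct1, rule_format, THEN conjunct1]
  and H_upper = H_class[unfolded Hclass_def, THEN conjunct1, rule_format, THEN conjunct2]
  and H_Lip_p = H_class[unfolded Hclass_def, THEN conjunct2, THEN conjunct1, rule_format]
  and H_Lip_x = H_class[unfolded Hclass_def, THEN conjunct2, THEN conjunct2, rule_format]

lemma H_ge: "- 1 / \<alpha>0 \<le> H x p"
proof -
  have "0 \<le> \<alpha>0 * \<bar>p\<bar> powr \<gamma>" using \<alpha>0_pos by simp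
  then show ?thesis using H_lower[of p x] by simp
qed

lemma H_cont: "continuous_on UNIV (\<lambda>(x, p). H x p)"
proof -
  have "((\<lambda>z. case z of (x, p) \<Rightarrow> H x p) \<longlongrightarrow> H x p) (at (x, p))" for x p
  proof -
    define B where "B z = \<alpha>1 * (\<bar>snd z\<bar> + \<bar>p\<bar> + 1) powr (\<gamma> - 1) * \<bar>snd z - p\<bar>
        + \<alpha>1 * (\<bar>p\<bar> powr \<gamma> + 1) * \<bar>fst z - x\<bar>" for z :: "real \<times> real"
    have fs: "(fst \<longlongrightarrow> x) (at (x, p))" "(snd \<longlongrightarrow> p) (at (x, p))"
      using tendsto_fst[OF tendsto_ident_at, of "(x, p)" UNIV] tendsto_snd[OF tendsto_ident_at, of "(x, p)" UNIV]
      by auto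
    have "((\<lambda>z. (case z of (x, p) \<Rightarrow> H x p) - H x p) \<longlongrightarrow> 0) (at (x, p))"
    proof (rule Lim_null_comparison)
      have "norm (H y q - H x p) \<le> B (y, q)" for y q
        using H_Lip_p[of y q p] H_Lip_x[of y p x] unfolding B_def fst_conv snd_conv real_norm_def by linarith
      then show "\<forall>\<^sub>F z in at (x, p). norm ((case z of (x, p) \<Rightarrow> H x p) - H x p) \<le> B z"
        by (intro always_eventually) auto
      have "(B \<longlongrightarrow> \<alpha>1 * (\<bar>p\<bar> + \<bar>p\<bar> + 1) powr (\<gamma> - 1) * \<bar>p - p\<bar>
          + \<alpha>1 * (\<bar>p\<bar> powr \<gamma> + 1) * \<bar>x - x\<bar>) (at (x, p))"
        unfolding B_def by (intro tendsto_intros fs) linarith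
      then show "(B \<longlongrightarrow> 0) (at (x, p))" by simp
    qed
    then show ?thesis by (simp add: LIM_zero_iff)
  qed
  then show ?thesis by (auto simp: continuous_on_def)
qed

lemma continuous_H:
  assumes "continuous_on S f" "continuous_on S g"
  shows "continuous_on S (\<lambda>z. H (f z) (g z))"
proof -
  have "continuous_on S (\<lambda>z. (f z, g z))" using assms by (intro continuous_intros)
  from continuous_on_compose2[OF H_cont this] show ?thesis by simp
qed

lemma sub_at_stable:
  assumes \<delta>: "0 < \<delta>"
    and approx: "\<And>e. 0 < e \<Longrightarrow> \<exists>u. continuous_on UNIV u \<and> w x - e \<le> u x \<and>
        (\<forall>z. \<bar>z - x\<bar> < \<delta> \<longrightarrow> u z \<le> w z + e \<and> sub_at a H l u z)"
  shows "sub_at a H l w x"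
  unfolding sub_at_def
proof (rule super_at_stable[OF a_cont _ \<delta>])
  show "continuous_on UNIV (\<lambda>(x, p). - H x (- p))"
    unfolding case_prod_beta by (intro continuous_intros continuous_H)
  fix e :: real assume e: "e > 0"
  obtain u where "continuous_on UNIV u" "w x - e \<le> u x"
    "\<And>z. \<bar>z - x\<bar> < \<delta> \<Longrightarrow> u z \<le> w z + e \<and> sub_at a H l u z"
    using approx[OF e] by auto
  then show "\<exists>v. continuous_on UNIV v \<and> v x \<le> - w x + e \<and>
      (\<forall>z. \<bar>z - x\<bar> < \<delta> \<longrightarrow> - w z - e \<le> v z \<and> super_at a (\<lambda>x p. - H x (- p)) (- l + e) v z)"
    using e super_at_mono[of a "\<lambda>x p. - H x (- p)" "- l" "\<lambda>z. - u z" _ "- l + e"]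
    by (intro exI[of _ "\<lambda>z. - u z"]) (auto intro!: continuous_intros simp: sub_at_def algebra_simps)
qed

lemma visc_super_lipschitz: "visc_super a H l u \<Longrightarrow> (grad_bound \<alpha>0 l)-lipschitz_on UNIV u"
  by (rule super_lipschitz[OF _ a_nonneg a_le_1 H_lower \<alpha>0_pos \<gamma>_gt_2])

lemma visc_super_mono: "visc_super a H l u \<Longrightarrow> l \<le> l' \<Longrightarrow> visc_super a H l' u"
  by (simp add: visc_super_iff super_at_mono[of a H l])

lemma visc_super_shift: "visc_super a H l u \<Longrightarrow> visc_super a H l (\<lambda>x. u x - c)"
  unfolding visc_super_iff super_at_shift by (auto intro!: continuous_intros)

text \<open>Constants have slope 0, where the growth bound reads
  \<open>H x 0 \<le> \<alpha>1\<close>. This both makes the set of admissible levels nonempty and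
  bounds its infimum from above.\<close>

lemma visc_super_zero: "visc_super a H \<alpha>1 (\<lambda>_. 0)"
  unfolding visc_super_iff super_at_def
proof (intro conjI allI impI)
  fix x p q assume "below_jet (\<lambda>_. 0::real) x p q"
  then have "below_jet (\<lambda>z. 0 + 0 * (z - x) + 0 * (z - x)\<^sup>2) x p q" by simp
  from below_jet_parabola[OF this] have "p = 0" "q \<le> 0" by auto
  moreover have "a x * (2 * q) \<le> 0" using a_nonneg[of x] \<open>q \<le> 0\<close> by (intro mult_nonneg_nonpos) auto
  moreover have "H x 0 \<le> \<alpha>1" using H_upper[of x 0] by simp
  ultimately show "a x * (2 * q) + H x p \<le> \<alpha>1" by (metis add_mono add_0)
qed simp

text \<open>A supersolution has linear growth, hence \<open>u + \<eta> z\<^sup>2\<close> attains its minimum.\<close>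

lemma visc_super_level_ge:
  assumes super: "visc_super a H l u" and m: "\<And>x p. m \<le> H x p"
  shows "m \<le> l"
proof (rule field_le_epsilon)
  fix e :: real assume e: "e > 0"
  define K where "K = grad_bound \<alpha>0 l"
  have lip: "K-lipschitz_on UNIV u" unfolding K_def by (rule visc_super_lipschitz[OF super])
  have K0: "0 \<le> K" using lip lipschitz_on_nonneg by blast
  have ulow: "u 0 - K * \<bar>z\<bar> \<le> u z" for z
    using lipschitz_onD[OF lip, of z 0] by (auto simp: dist_real_def)
  define g where "g z = u z + e / 2 * z\<^sup>2" for z
  \<comment> \<open>Beyond this radius \<open>e / 2 * \<bar>v\<bar>\<close> exceeds
    \<open>K\<close>, so the quadratic term outweighs the largest possible linear decrease of
    \<open>u\<close> and a minimum over \<open>{- R..R}\<close> is global.\<close>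
  define R where "R = 2 * K / e + 1"
  have R: "0 < R" using K0 e by (auto simp: R_def intro: add_nonneg_pos)
  have "continuous_on {- R..R} g"
    unfolding g_def using super
    by (auto simp: visc_super_def intro!: continuous_intros intro: continuous_on_subset)
  from continuous_attains_inf[OF _ _ this] obtain z
    where z: "z \<in> {- R..R}" and min: "\<And>v. v \<in> {- R..R} \<Longrightarrow> g z \<le> g v" using R by auto
  have glob: "g z \<le> g v" for v
  proof (cases "v \<in> {- R..R}")
    case False
    then have v: "R < \<bar>v\<bar>" by auto
    have "K \<le> e / 2 * \<bar>v\<bar>" using v e by (simp add: R_def field_simps)
    then have "K * \<bar>v\<bar> \<le> e / 2 * \<bar>v\<bar> * \<bar>v\<bar>" by (rule mult_right_mono) simp
    then have "g 0 \<le> g v" using ulow[of v] by (simp add: g_def power2_eq_square)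
    then show ?thesis using min[of 0] R by simp
  qed (use min in auto)
  have "below_jet u z (- e * z) (- e / 2)"
    unfolding below_jet_def
  proof (intro exI[of _ 1] conjI allI impI)
    fix v show "u z + - e * z * (v - z) + - e / 2 * (v - z)\<^sup>2 \<le> u v"
      using glob[of v] by (simp add: g_def power2_eq_square field_simps)
  qed simp
  then have "a z * (2 * (- e / 2)) + H z (- e * z) \<le> l"
    by (rule super_atD[rotated]) (use super in \<open>simp add: visc_super_iff\<close>)
  moreover have "a z * e \<le> 1 * e" using a_le_1[of z] e by (intro mult_right_mono) auto
  ultimately show "m \<le> l + e" using m[of z "- e * z"] by simp
qed

section \<open>The minimal supersolution vanishing at a point\<close>

text \<open>The condition \<open>u y = 0\<close> together with the common Lipschitz constant gives
  every member the lower bound \<open>- K * \<bar>x - y\<bar>\<close>, so the infimum is finite.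
  Nonemptiness of the family comes from shifting the supersolution \<open>u0\<close>.\<close>

definition minimal_super :: "real \<Rightarrow> real \<Rightarrow> real \<Rightarrow> real" where
  "minimal_super l y x = (INF u\<in>{u. visc_super a H l u \<and> u y = 0}. u x)"

context
  fixes l u0
  assumes u0: "visc_super a H l u0"
begin

abbreviation "K \<equiv> grad_bound \<alpha>0 l"

lemma minimal_super_le:
  assumes "visc_super a H l u" "u y = 0"
  shows "minimal_super l y x \<le> u x"
proof -
  have "- K * \<bar>x - y\<bar> \<le> v x" if "visc_super a H l v" "v y = 0" for v
    using lipschitz_onD[OF visc_super_lipschitz[OF that(1)], of x y] that(2)
    by (auto simp: dist_real_def)
  then show ?thesis
    unfolding minimal_super_def using assms
    by (intro cINF_lower bdd_belowI[of _ "- K * \<bar>x - y\<bar>"]) auto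
qed

lemma minimal_super_greatest:
  assumes "\<And>u. visc_super a H l u \<Longrightarrow> u y = 0 \<Longrightarrow> b \<le> u x"
  shows "b \<le> minimal_super l y x"
  unfolding minimal_super_def
proof (rule cINF_greatest)
  show "{u. visc_super a H l u \<and> u y = 0} \<noteq> {}"
    using visc_super_shift[OF u0, of "u0 y"] by force
  show "b \<le> u x" if "u \<in> {u. visc_super a H l u \<and> u y = 0}" for u
    using that by (intro assms) simp_all
qed

lemma minimal_super_self: "minimal_super l y y = 0"
proof (rule antisym)
  show "minimal_super l y y \<le> 0"
    using minimal_super_le[OF visc_super_shift[OF u0, of "u0 y"], of y y] by simp
qed (rule minimal_super_greatest, simp)

lemma minimal_super_lipschitz: "K-lipschitz_on UNIV (minimal_super l y)"
proof (rule lipschitz_onI)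
  have *: "minimal_super l y x - K * \<bar>x - z\<bar> \<le> minimal_super l y z" for x z
  proof (rule minimal_super_greatest)
    fix u assume u: "visc_super a H l u" "u y = 0"
    show "minimal_super l y x - K * \<bar>x - z\<bar> \<le> u z"
      using minimal_super_le[OF u, of x] lipschitz_onD[OF visc_super_lipschitz[OF u(1)], of x z]
      by (auto simp: dist_real_def)
  qed
  show "dist (minimal_super l y x) (minimal_super l y z) \<le> K * dist x z" for x z
    using *[of x z] *[of z x] by (auto simp: dist_real_def abs_minus_commute)
  show "0 \<le> K" using visc_super_lipschitz[OF u0] lipschitz_on_nonneg by blast
qed

lemma minimal_super_visc_super: "visc_super a H l (minimal_super l y)"
  unfolding visc_super_iff
proof (intro conjI allI)
  show "continuous_on UNIV (minimal_super l y)"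
    by (rule lipschitz_on_continuous_on[OF minimal_super_lipschitz])
  fix x
  show "super_at a H l (minimal_super l y) x"
  proof (rule super_at_stable[OF a_cont H_cont zero_less_one])
    fix e :: real assume e: "e > 0"
    \<comment> \<open>Near-attainment is needed at \<open>x\<close> alone. Around \<open>x\<close>
      stability asks only that the member not fall below the infimum, which holds by
      definition.\<close>
    obtain u where u: "visc_super a H l u" "u y = 0" "u x < minimal_super l y x + e"
      using minimal_super_greatest[of y "minimal_super l y x + e" x] e by force
    then show "\<exists>u. continuous_on UNIV u \<and> u x \<le> minimal_super l y x + e \<and>
        (\<forall>z. \<bar>z - x\<bar> < 1 \<longrightarrow> minimal_super l y z - e \<le> u z \<and> super_at a H (l + e) u z)"
      using minimal_super_le[OF u(1,2)] e visc_super_mono[OF u(1), of "l + e"]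
      by (intro exI[of _ u]) (auto simp: visc_super_iff diff_le_eq intro: add_increasing2)
  qed
qed

text \<open>Where the subsolution property fails, a strict supersolution parabola slightly below its
  contact point with the minimal supersolution can be cut in, contradicting minimality.\<close>

lemma minimal_super_sub_at:
  assumes xy: "x \<noteq> y"
  shows "sub_at a H l (minimal_super l y) x"
proof (rule ccontr)
  define w where "w = minimal_super l y"
  assume "\<not> sub_at a H l (minimal_super l y) x"
  then obtain p q where jet: "below_jet (\<lambda>z. - w z) x p q" and viol: "- l < a x * (2 * q) - H x (- p)"
    unfolding sub_at_def super_at_def w_def by force
  define P where "P = - p"
  define F where "F Q z = a z * (2 * Q) + H z (P + 2 * Q * (z - x))" for Q z
  obtain \<delta> where \<delta>: "\<delta> > 0" and above: "\<And>z. \<bar>z - x\<bar> < \<delta> \<Longrightarrow> w z \<le> w x + P * (z - x) - q * (z - x)\<^sup>2"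
    using jet unfolding below_jet_def P_def by (force simp: algebra_simps)
  \<comment> \<open>A quarter of the amount by which the test fails. Opening the parabola by
    \<open>\<eta>\<close> raises the operator at \<open>x\<close> by at most
    \<open>2 * \<eta>\<close>, since \<open>a x \<le> 1\<close>, and so leaves half of the strict
    gap.\<close>
  define \<eta> where "\<eta> = (l - F (- q) x) / 4"
  have \<eta>: "\<eta> > 0" using viol by (simp add: \<eta>_def F_def P_def)
  define Q where "Q = \<eta> - q"
  have "a x * \<eta> \<le> 1 * \<eta>" using a_le_1[of x] \<eta> by (intro mult_right_mono) auto
  moreover have "F Q x = F (- q) x + 2 * (a x * \<eta>)" by (simp add: F_def Q_def algebra_simps)
  ultimately have "F Q x \<le> F (- q) x + 2 * \<eta>" by simp
  moreover have "l = F (- q) x + 4 * \<eta>" by (simp add: \<eta>_def field_simps)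
  ultimately have FQ: "F Q x < l" using \<eta> by linarith
  have "continuous_on UNIV (F Q)"
    unfolding F_def by (intro continuous_intros a_cont continuous_H)
  then have "isCont (F Q) x" by (simp add: continuous_on_eq_continuous_at)
  then obtain d where d: "d > 0" and Fd: "\<And>z. \<bar>z - x\<bar> < d \<Longrightarrow> F Q z < l"
    using isCont_less_nbhd FQ by blast
  \<comment> \<open>Small enough that \<open>y\<close> lies outside the modified interval, that
    \<open>w\<close> stays below the original parabola there, and that the new parabola is still a
    strict supersolution.\<close>
  define s where "s = min (\<bar>x - y\<bar>) (min \<delta> d) / 2"
  have s: "0 < s" "s < \<bar>x - y\<bar>" "s < \<delta>" "s < d"
    using xy \<delta> d unfolding s_def by (auto simp: min_def)
  \<comment> \<open>The lowering by \<open>\<eta> * s\<^sup>2\<close> is exactly what the wider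
    opening regains at distance \<open>s\<close>: there \<open>\<phi>\<close> is back above
    \<open>w\<close> and the minimum glues continuously, while at the centre \<open>\<phi>\<close>
    is strictly below \<open>w\<close>.\<close>
  define \<phi> where "\<phi> z = (w x - \<eta> * s\<^sup>2) + P * (z - x) + Q * (z - x)\<^sup>2" for z
  define v where "v z = (if \<bar>z - x\<bar> \<le> s then min (w z) (\<phi> z) else w z)" for z
  have w\<phi>: "w z \<le> \<phi> z" if "\<bar>z - x\<bar> = s" for z
  proof -
    have "(z - x)\<^sup>2 = s\<^sup>2" using that by (metis power2_abs)
    then show ?thesis using above[of z] that s by (simp add: \<phi>_def Q_def algebra_simps)
  qed
  have cw: "continuous_on UNIV w" and sw: "\<And>z. super_at a H l w z"
    using minimal_super_visc_super[of y] by (auto simp: visc_super_iff w_def)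
  have cont: "continuous_on UNIV v"
    unfolding v_def
  proof (rule continuous_on_cases_le)
    show "continuous_on {t \<in> UNIV. \<bar>t - x\<bar> \<le> s} (\<lambda>z. min (w z) (\<phi> z))"
      unfolding \<phi>_def by (intro continuous_intros continuous_on_subset[OF cw]) auto
  qed (auto intro!: continuous_intros continuous_on_subset[OF cw] simp: w\<phi> min_absorb1)
  have "super_at a H l v z" for z
    unfolding super_at_def
  proof (intro allI impI)
    fix p' q' assume j: "below_jet v z p' q'"
    then obtain r where r: "r > 0" "\<And>t. \<bar>t - z\<bar> < r \<Longrightarrow> v z + p' * (t - z) + q' * (t - z)\<^sup>2 \<le> v t"
      unfolding below_jet_def by auto
    show "a z * (2 * q') + H z p' \<le> l"
    proof (cases "v z = w z")
      case True
      have "v t \<le> w t" for t by (simp add: v_def)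
      then have "below_jet w z p' q'"
        unfolding below_jet_def using r True by (metis order_trans)
      then show ?thesis by (rule super_atD[OF sw])
    next
      case False
      \<comment> \<open>Where \<open>v\<close> differs from \<open>w\<close> it equals
        \<open>\<phi>\<close>, and \<open>w\<phi>\<close> keeps such a point off the boundary. Hence
        \<open>v \<le> \<phi>\<close> around it, and a parabola touching \<open>v\<close> from below
        also touches \<open>\<phi>\<close>.\<close>
      then have zs: "\<bar>z - x\<bar> < s" and vz: "v z = \<phi> z"
        using w\<phi>[of z] by (auto simp: v_def min_def less_le split: if_splits)
      have "v t \<le> \<phi> t" if "\<bar>t - z\<bar> < s - \<bar>z - x\<bar>" for t
        using that by (auto simp: v_def)
      then have "below_jet \<phi> z p' q'"
        unfolding below_jet_def using r(1) zs order_trans[OF r(2)]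
        by (intro exI[of _ "min r (s - \<bar>z - x\<bar>)"]) (simp add: vz)
      from below_jet_parabola[OF this[unfolded \<phi>_def[abs_def]]]
      have p': "p' = P + 2 * Q * (z - x)" and "q' \<le> Q" by auto
      then have "a z * (2 * q') \<le> a z * (2 * Q)" using a_nonneg by (intro mult_left_mono) auto
      moreover have "F Q z < l" using zs s by (intro Fd) auto
      ultimately show ?thesis unfolding F_def p' by linarith
    qed
  qed
  with cont have "visc_super a H l v" by (simp add: visc_super_iff)
  moreover have "v y = 0" using s minimal_super_self[of y] by (simp add: v_def w_def abs_minus_commute)
  ultimately have "w x \<le> v x" unfolding w_def by (rule minimal_super_le)
  moreover have "0 < \<eta> * s\<^sup>2" using s \<eta> by simp
  then have "v x < w x" using s by (simp add: v_def \<phi>_def min_def)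
  ultimately show False by simp
qed

lemma solution_exists:
  obtains u where "K-lipschitz_on UNIV u" "\<And>x. super_at a H l u x" "\<And>x. sub_at a H l u x"
proof -
  define f where "f n x = minimal_super l (real n) x - minimal_super l (real n) 0" for n x
  have lip: "K-lipschitz_on UNIV (f n)" for n
    using minimal_super_lipschitz[of "real n"] unfolding f_def lipschitz_on_def by (simp add: dist_real_def)
  have f0: "f n 0 = 0" for n by (simp add: f_def)
  from lipschitz_subsequence[of K f, OF lip f0] obtain k u where k: "strict_mono k"
    and u: "K-lipschitz_on UNIV u"
    and unif: "\<And>R e. 0 < e \<Longrightarrow> \<forall>\<^sub>F n in sequentially. \<forall>x. \<bar>x\<bar> \<le> R \<longrightarrow> \<bar>f (k n) x - u x\<bar> < e"
    by blast
  have super: "super_at a H l (f n) x" for n x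
    using minimal_super_visc_super[of "real n"] unfolding f_def super_at_shift visc_super_iff by auto
  have sub: "sub_at a H l (f n) x" if "x \<noteq> real n" for n x
    unfolding f_def sub_at_shift using that by (rule minimal_super_sub_at)
  \<comment> \<open>The pinned point of \<open>f n\<close> is \<open>n\<close> itself, so
    \<open>\<bar>x\<bar> + 1 < real n\<close> keeps it outside the unit neighbourhood of
    \<open>x\<close> on which the subsolution property is passed to the limit.\<close>
  have approx: "\<exists>n. (\<forall>z. \<bar>z - x\<bar> < 1 \<longrightarrow> \<bar>f n z - u z\<bar> < e) \<and> \<bar>x\<bar> + 1 < real n" if e: "e > 0" for x e
  proof -
    have "\<forall>\<^sub>F n in sequentially. \<bar>x\<bar> + 1 < real n"
      by (rule eventually_gt_at_top[THEN filterlim_real_sequentially[unfolded filterlim_iff, rule_format]])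
    then have "\<forall>\<^sub>F n in sequentially. \<bar>x\<bar> + 1 < real (k n)"
      using filterlim_subseq[OF k] by (auto simp: filterlim_iff)
    with unif[OF e, of "\<bar>x\<bar> + 1"]
    have "\<forall>\<^sub>F n in sequentially. (\<forall>z. \<bar>z\<bar> \<le> \<bar>x\<bar> + 1 \<longrightarrow> \<bar>f (k n) z - u z\<bar> < e) \<and> \<bar>x\<bar> + 1 < real (k n)"
      by eventually_elim auto
    then obtain n where "\<forall>z. \<bar>z\<bar> \<le> \<bar>x\<bar> + 1 \<longrightarrow> \<bar>f (k n) z - u z\<bar> < e" "\<bar>x\<bar> + 1 < real (k n)"
      by (auto simp: eventually_sequentially)
    then show ?thesis by (intro exI[of _ "k n"]) auto
  qed
  have cf: "continuous_on UNIV (f n)" for n by (rule lipschitz_on_continuous_on[OF lip])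
  show ?thesis
  proof (rule that[OF u])
    fix x
    show "super_at a H l u x"
    proof (rule super_at_stable[OF a_cont H_cont zero_less_one])
      fix e :: real assume e: "e > 0"
      from approx[OF e, of x] obtain n where n: "\<And>z. \<bar>z - x\<bar> < 1 \<Longrightarrow> \<bar>f n z - u z\<bar> < e" by auto
      show "\<exists>v. continuous_on UNIV v \<and> v x \<le> u x + e \<and>
          (\<forall>z. \<bar>z - x\<bar> < 1 \<longrightarrow> u z - e \<le> v z \<and> super_at a H (l + e) v z)"
        using n e cf super_at_mono[OF super, of "l + e"]
        by (intro exI[of _ "f n"]) (auto simp: abs_less_iff algebra_simps intro!: less_imp_le)
    qed
    show "sub_at a H l u x"
    proof (rule sub_at_stable[OF zero_less_one])
      fix e :: real assume e: "e > 0"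
      from approx[OF e, of x] obtain n where n: "\<And>z. \<bar>z - x\<bar> < 1 \<Longrightarrow> \<bar>f n z - u z\<bar> < e"
        and "\<bar>x\<bar> + 1 < real n" by auto
      then have "sub_at a H l (f n) z" if "\<bar>z - x\<bar> < 1" for z
        using that by (intro sub) auto
      then show "\<exists>v. continuous_on UNIV v \<and> u x - e \<le> v x \<and>
          (\<forall>z. \<bar>z - x\<bar> < 1 \<longrightarrow> v z \<le> u z + e \<and> sub_at a H l v z)"
        using n cf
        by (intro exI[of _ "f n"]) (auto simp: abs_less_iff algebra_simps intro!: less_imp_le)
    qed
  qed
qed

end

section \<open>Closedness of the set of admissible levels\<close>

lemma visc_super_closed_level:
  assumes ex: "\<And>e. 0 < e \<Longrightarrow> \<exists>u. visc_super a H (l + e) u"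
  shows "\<exists>u. visc_super a H l u"
proof -
  define \<epsilon> where "\<epsilon> n = inverse (real (Suc n))" for n
  have \<epsilon>: "0 < \<epsilon> n" "\<epsilon> n \<le> 1" for n by (auto simp: \<epsilon>_def field_simps)
  obtain g where g: "\<And>n. visc_super a H (l + \<epsilon> n) (g n)" using ex[OF \<epsilon>(1)] by metis
  define f where "f n x = g n x - g n 0" for n x
  have f: "visc_super a H (l + \<epsilon> n) (f n)" for n
    unfolding f_def by (rule visc_super_shift[OF g])
  \<comment> \<open>The levels vary with \<open>n\<close>, but all are at most \<open>l + 1\<close>;
    raising them to that level gives one Lipschitz constant for the whole sequence.\<close>
  have lip: "(grad_bound \<alpha>0 (l + 1))-lipschitz_on UNIV (f n)" for n
    by (rule visc_super_lipschitz[OF visc_super_mono[OF f]]) (simp add: \<epsilon>)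
  have f0: "f n 0 = 0" for n by (simp add: f_def)
  from lipschitz_subsequence[of _ f, OF lip f0] obtain k u where k: "strict_mono k"
    and u: "(grad_bound \<alpha>0 (l + 1))-lipschitz_on UNIV u"
    and unif: "\<And>R e. 0 < e \<Longrightarrow> \<forall>\<^sub>F n in sequentially. \<forall>x. \<bar>x\<bar> \<le> R \<longrightarrow> \<bar>f (k n) x - u x\<bar> < e"
    by blast
  have "super_at a H l u x" for x
  proof (rule super_at_stable[OF a_cont H_cont zero_less_one])
    fix e :: real assume e: "e > 0"
    have "\<epsilon> \<longlonglongrightarrow> 0" unfolding \<epsilon>_def by (rule LIMSEQ_inverse_real_of_nat)
    then have "(\<lambda>n. \<epsilon> (k n)) \<longlonglongrightarrow> 0" using LIMSEQ_subseq_LIMSEQ[OF _ k] by (force simp: o_def)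
    then have "\<forall>\<^sub>F n in sequentially. \<epsilon> (k n) < e" using e by (rule order_tendstoD)
    with unif[OF e, of "\<bar>x\<bar> + 1"]
    have "\<forall>\<^sub>F n in sequentially. (\<forall>z. \<bar>z\<bar> \<le> \<bar>x\<bar> + 1 \<longrightarrow> \<bar>f (k n) z - u z\<bar> < e) \<and> \<epsilon> (k n) < e"
      by eventually_elim auto
    then obtain n where n: "\<And>z. \<bar>z\<bar> \<le> \<bar>x\<bar> + 1 \<Longrightarrow> \<bar>f (k n) z - u z\<bar> < e" "\<epsilon> (k n) < e"
      by (auto simp: eventually_sequentially)
    have "visc_super a H (l + e) (f (k n))"
      by (rule visc_super_mono[OF f]) (use n in auto)
    moreover have "\<bar>f (k n) z - u z\<bar> < e" if "\<bar>z - x\<bar> < 1" for z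
      using that by (intro n(1)) auto
    ultimately show "\<exists>v. continuous_on UNIV v \<and> v x \<le> u x + e \<and>
        (\<forall>z. \<bar>z - x\<bar> < 1 \<longrightarrow> u z - e \<le> v z \<and> super_at a H (l + e) v z)"
      by (intro exI[of _ "f (k n)"]) (auto simp: visc_super_iff abs_less_iff algebra_simps intro!: less_imp_le)
  qed
  then show ?thesis
    using lipschitz_on_continuous_on[OF u] by (auto simp: visc_super_iff)
qed

section \<open>Regularity where the diffusion is positive\<close>

context
  fixes u l K
  assumes lip: "K-lipschitz_on UNIV u"
    and super: "\<And>x. super_at a H l u x" and sub: "\<And>x. sub_at a H l u x"
begin

lemma sub_below_jet:
  assumes "below_jet (\<lambda>z. - u z) x p q"
  shows "a x * (2 * q) \<le> H x (- p) - l"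
  using super_atD[OF sub[unfolded sub_at_def] assms] by simp

lemma u_cont: "continuous_on UNIV u"
  by (rule lipschitz_on_continuous_on[OF lip])

text \<open>Near \<open>x\<close> the coefficient \<open>a\<close> exceeds half of
  \<open>a x\<close>, so dividing by it turns both viscosity inequalities into bounds on the
  curvature of touching parabolas. Then \<open>deriv_bounds\<close> makes \<open>u'\<close>
  Lipschitz around \<open>x\<close>.\<close>

lemma C1_where_positive:
  assumes ax: "0 < a x"
  shows "(u has_real_derivative deriv u x) (at x)" and "isCont (deriv u) x"
proof -
  \<comment> \<open>One number for both directions: \<open>1 / \<alpha>0\<close> bounds
    \<open>- H\<close> in the supersolution inequality. The term with \<open>K powr \<gamma>\<close>
    bounds \<open>H\<close> in the subsolution inequality, where slopes of touching parabolas are at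
    most \<open>K\<close>. The summand 1 in \<open>M\<close> below supplies strictness.\<close>
  define B where "B = \<bar>l\<bar> + 1 / \<alpha>0 + \<bar>\<alpha>1\<bar> * (K powr \<gamma> + 1)"
  have B0: "0 \<le> B" using \<alpha>0_pos by (simp add: B_def)
  define M where "M = B / (a x / 2) + 1"
  have "isCont a x" using a_cont by (simp add: continuous_on_eq_continuous_at)
  then obtain r where r: "r > 0" and ar: "\<And>z. \<bar>z - x\<bar> < r \<Longrightarrow> a x / 2 < a z"
    using isCont_less_nbhd[of x "\<lambda>z. - a z" "- (a x / 2)"] ax by auto
  have bound: "2 * q < M" if "a z * (2 * q) \<le> B" "\<bar>z - x\<bar> < r" for z q
  proof -
    have "0 < a z" using ar[OF that(2)] ax by linarith
    then have "2 * q \<le> B / a z" using that(1) by (simp add: field_simps)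
    also have "\<dots> \<le> B / (a x / 2)"
      using ar[OF that(2)] ax B0 by (intro divide_left_mono) auto
    finally show ?thesis by (simp add: M_def)
  qed
  have up: "2 * q < M" if z: "z \<in> {x - r<..<x + r}" and j: "below_jet u z p q" for z p q
  proof (rule bound)
    have "0 \<le> \<bar>\<alpha>1\<bar> * (K powr \<gamma> + 1)" by simp
    then show "a z * (2 * q) \<le> B"
      using super_atD[OF super j] H_ge[of z p] unfolding B_def by linarith
  qed (use z in auto)
  have lo: "2 * q < - (- M)" if z: "z \<in> {x - r<..<x + r}" and j: "below_jet (\<lambda>z. - u z) z p q" for z p q
    unfolding minus_minus
  proof (rule bound)
    have "K-lipschitz_on UNIV (\<lambda>z. - u z)" using lip by (simp add: lipschitz_on_def dist_real_def abs_minus_commute)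
    from below_jet_lipschitz[OF j this] have p: "\<bar>p\<bar> \<le> K" .
    have "H z (- p) \<le> \<alpha>1 * (\<bar>p\<bar> powr \<gamma> + 1)" using H_upper[of z "- p"] by simp
    also have "\<dots> \<le> \<bar>\<alpha>1\<bar> * (K powr \<gamma> + 1)"
      using p \<gamma>_gt_2 by (intro mult_mono add_right_mono powr_mono2) auto
    finally show "a z * (2 * q) \<le> B"
      using sub_below_jet[OF j] \<alpha>0_pos unfolding B_def by (smt (verit) divide_pos_pos)
  qed (use z in auto)
  have d1: "(u has_real_derivative deriv u z) (at z)" if "z \<in> {x - r<..<x + r}" for z
    using deriv_bounds(1)[of u "x - r" "x + r" M "- M" z] u_cont up lo that by blast
  have d2: "- M * (z - y) \<le> deriv u z - deriv u y \<and> deriv u z - deriv u y \<le> M * (z - y)"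
    if "y \<in> {x - r<..<x + r}" "z \<in> {x - r<..<x + r}" "y < z" for y z
    using deriv_bounds(2)[of u "x - r" "x + r" M "- M" y z] u_cont up lo that by blast
  show "(u has_real_derivative deriv u x) (at x)" using r by (intro d1) auto
  have diff: "\<bar>deriv u z - deriv u x\<bar> \<le> M * \<bar>z - x\<bar>" if "z \<in> {x - r<..<x + r}" for z
    using d2[of x z] d2[of z x] r that by (cases z x rule: linorder_cases) (auto simp: abs_le_iff algebra_simps)
  have "(\<lambda>z. deriv u z - deriv u x) \<midarrow>x\<rightarrow> 0"
  proof (rule Lim_null_comparison)
    have "\<forall>\<^sub>F z in at x. z \<in> {x - r<..<x + r}" using r by (intro eventually_at_in_open') auto
    then show "\<forall>\<^sub>F z in at x. norm (deriv u z - deriv u x) \<le> M * \<bar>z - x\<bar>"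
      by eventually_elim (use diff in auto)
    show "(\<lambda>z. M * \<bar>z - x\<bar>) \<midarrow>x\<rightarrow> 0" by (auto intro!: tendsto_eq_intros)
  qed
  then show "isCont (deriv u) x" by (simp add: isCont_def LIM_zero_iff)
qed

lemma continuous_rhs:
  "continuous_on {x. 0 < a x} (\<lambda>z. (l - H z (deriv u z)) / a z)"
proof -
  have "continuous_on {x. 0 < a x} (deriv u)"
    using C1_where_positive(2) by (auto intro: continuous_at_imp_continuous_on)
  then show ?thesis
    by (intro continuous_intros continuous_H continuous_on_subset[OF a_cont]) auto
qed

lemma open_positive: "open {x. 0 < a x}"
  using open_Collect_less[OF continuous_on_const a_cont] by simp

text \<open>With \<open>u\<close> differentiable, every touching parabola has slope
  \<open>u'\<close>, so its curvature is compared with the single function \<open>g\<close>. By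
  continuity \<open>g\<close> stays within \<open>e / 2\<close> of \<open>g x\<close> nearby, and
  \<open>deriv_bounds\<close> with the constants \<open>g x + e / 2\<close> and
  \<open>g x - e / 2\<close> squeezes the difference quotients of \<open>u'\<close>.\<close>

lemma deriv2_where_positive:
  assumes ax: "0 < a x"
  shows "(deriv u has_real_derivative (l - H x (deriv u x)) / a x) (at x)"
proof -
  define g where "g z = (l - H z (deriv u z)) / a z" for z
  have gcont: "isCont g x"
    using continuous_rhs open_positive ax unfolding g_def
    by (simp add: continuous_on_eq_continuous_at)
  have "(\<lambda>z. (deriv u z - deriv u x) / (z - x)) \<midarrow>x\<rightarrow> g x"
    unfolding tendsto_iff
  proof (intro allI impI)
    fix e :: real assume e: "e > 0"
    have "\<forall>\<^sub>F z in nhds x. \<bar>g z - g x\<bar> < e / 2 \<and> 0 < a z"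
    proof (rule eventually_conj)
      have "(g \<longlongrightarrow> g x) (nhds x)" using gcont by (simp add: isCont_def tendsto_at_iff_tendsto_nhds)
      from tendstoD[OF this, of "e / 2"] e show "\<forall>\<^sub>F z in nhds x. \<bar>g z - g x\<bar> < e / 2"
        by (simp add: dist_real_def)
      show "\<forall>\<^sub>F z in nhds x. 0 < a z"
        using eventually_nhds_in_open[OF open_positive, of x] ax by simp
    qed
    then obtain r where r: "r > 0"
      and near: "\<And>z. \<bar>z - x\<bar> < r \<Longrightarrow> \<bar>g z - g x\<bar> < e / 2 \<and> 0 < a z"
      unfolding eventually_nhds_metric dist_real_def by blast
    have up: "2 * q < g x + e / 2" if z: "z \<in> {x - r<..<x + r}" and j: "below_jet u z p q" for z p q
    proof -
      have n: "\<bar>g z - g x\<bar> < e / 2" "0 < a z" using near[of z] z by auto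
      from below_jet_deriv[OF j C1_where_positive(1)[OF n(2)]] super_atD[OF super j] n(2)
      have "2 * q \<le> g z" by (simp add: g_def field_simps)
      then show ?thesis using n(1) by linarith
    qed
    have lo: "2 * q < - (g x - e / 2)"
      if z: "z \<in> {x - r<..<x + r}" and j: "below_jet (\<lambda>z. - u z) z p q" for z p q
    proof -
      have n: "\<bar>g z - g x\<bar> < e / 2" "0 < a z" using near[of z] z by auto
      have "p = - deriv u z"
        by (rule below_jet_deriv[OF j DERIV_minus[OF C1_where_positive(1)[OF n(2)]]])
      with sub_below_jet[OF j] n(2) have "2 * q \<le> - g z" by (simp add: g_def field_simps)
      then show ?thesis using n(1) by linarith
    qed
    have d: "(g x - e / 2) * (z - y) \<le> deriv u z - deriv u y \<and>
        deriv u z - deriv u y \<le> (g x + e / 2) * (z - y)"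
      if "y \<in> {x - r<..<x + r}" "z \<in> {x - r<..<x + r}" "y < z" for y z
      using deriv_bounds(2)[of u "x - r" "x + r" "g x + e / 2" "g x - e / 2" y z] u_cont up lo that
      by blast
    have "\<bar>(deriv u z - deriv u x) / (z - x) - g x\<bar> < e" if z: "z \<in> {x - r<..<x + r}" "z \<noteq> x" for z
    proof -
      have "g x - e / 2 \<le> (deriv u z - deriv u x) / (z - x) \<and> (deriv u z - deriv u x) / (z - x) \<le> g x + e / 2"
      proof (cases z x rule: linorder_cases)
        case less
        have "(deriv u z - deriv u x) / (z - x) = (deriv u x - deriv u z) / (x - z)"
          by (metis minus_diff_eq minus_divide_divide)
        then show ?thesis using d[of z x] z r less by (simp add: pos_le_divide_eq pos_divide_le_eq)
      next
        case greater
        then show ?thesis using d[of x z] z r by (simp add: pos_le_divide_eq pos_divide_le_eq)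
      qed (use z in simp)
      then show ?thesis using e by (simp add: abs_if)
    qed
    moreover have "\<forall>\<^sub>F z in at x. z \<in> {x - r<..<x + r}" using r by (intro eventually_at_in_open') auto
    moreover have "\<forall>\<^sub>F z in at x. z \<noteq> x" by (simp add: eventually_at_filter)
    ultimately show "\<forall>\<^sub>F z in at x. dist ((deriv u z - deriv u x) / (z - x)) (g x) < e"
      by (auto elim: eventually_elim2 simp: dist_real_def)
  qed
  then show ?thesis by (simp add: has_field_derivative_iff g_def)
qed

lemma C2_on_positive:
  assumes I: "I \<subseteq> {x. 0 < a x}"
  shows "C2_on I u"
  unfolding C2_on_def
proof (intro conjI)
  show "u differentiable_on I" "deriv u differentiable_on I"
    unfolding differentiable_on_def real_differentiable_def
    using I C1_where_positive(1) deriv2_where_positive by (blast intro: has_field_derivative_at_within)+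
  show "continuous_on I (deriv (deriv u))"
    by (rule continuous_on_eq[OF continuous_on_subset[OF continuous_rhs I]])
      (use I in \<open>auto intro!: DERIV_imp_deriv[symmetric] deriv2_where_positive\<close>)
qed

end

end

section \<open>Bounds on the critical level and existence from it upwards\<close>

lemma lambda0_bounds:
  assumes "viscous_HJ a H \<alpha>0 \<alpha>1 \<gamma>"
  shows "- 1 / \<alpha>0 \<le> Inf (range (\<lambda>(x, p). H x p))"
    and "Inf (range (\<lambda>(x, p). H x p)) \<le> lambda0 a H"
    and "lambda0 a H \<le> \<alpha>1"
proof -
  interpret viscous_HJ a H \<alpha>0 \<alpha>1 \<gamma> by fact
  show "- 1 / \<alpha>0 \<le> Inf (range (\<lambda>(x, p). H x p))"
    by (rule cInf_greatest) (use H_ge in auto)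
  \<comment> \<open>A real \<open>Inf\<close> is a genuine infimum only for a nonempty set bounded
    below; the same point is settled for the set of levels further on.\<close>
  have bdd: "bdd_below (range (\<lambda>(x, p). H x p))"
    by (rule bdd_belowI[of _ "- 1 / \<alpha>0"]) (use H_ge in auto)
  have m: "Inf (range (\<lambda>(x, p). H x p)) \<le> H x p" for x p
    by (rule cInf_lower[OF _ bdd]) force
  have level: "Inf (range (\<lambda>(x, p). H x p)) \<le> l" if "visc_super a H l u" for l u
    by (rule visc_super_level_ge[OF that m])
  show "Inf (range (\<lambda>(x, p). H x p)) \<le> lambda0 a H"
    unfolding lambda0_def using visc_super_zero level by (intro cInf_greatest) auto
  show "lambda0 a H \<le> \<alpha>1"
    unfolding lambda0_def
  proof (rule cInf_lower)
    show "bdd_below {l. \<exists>u. visc_super a H l u}"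
      unfolding bdd_below_def using level by blast
  qed (use visc_super_zero in blast)
qed

lemma exists_visc_super_above_lambda0:
  assumes "viscous_HJ a H \<alpha>0 \<alpha>1 \<gamma>" and le: "lambda0 a H \<le> l"
  shows "\<exists>u. visc_super a H l u"
proof -
  interpret viscous_HJ a H \<alpha>0 \<alpha>1 \<gamma> by fact
  show ?thesis
  proof (rule visc_super_closed_level)
    fix e :: real assume "e > 0"
    then have "Inf {l. \<exists>u. visc_super a H l u} < l + e" using le by (simp add: lambda0_def)
    moreover have "{l. \<exists>u. visc_super a H l u} \<noteq> {}" using visc_super_zero by auto
    ultimately obtain l' u where "visc_super a H l' u" "l' < l + e"
      using cInf_lessD[of "{l. \<exists>u. visc_super a H l u}" "l + e"] by auto
    then show "\<exists>u. visc_super a H (l + e) u" using visc_super_mono[of l' u "l + e"] by auto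
  qed
qed

theorem mainTheorem5:
  fixes \<alpha>0 \<alpha>1 \<gamma> \<kappa> :: real
  assumes "\<alpha>0 > 0" and "\<gamma> > 2"
  shows "\<forall>lam::real. \<exists>K::real. \<forall>(a :: real \<Rightarrow> 'w \<Rightarrow> real) (H :: real \<Rightarrow> real \<Rightarrow> 'w \<Rightarrow> real) \<omega>.
     (\<forall>x \<omega>'. 0 \<le> a x \<omega>' \<and> a x \<omega>' \<le> 1) \<and>
     (\<forall>\<omega>'. \<kappa>-lipschitz_on UNIV (\<lambda>x. sqrt (a x \<omega>'))) \<and>
     (\<forall>\<omega>'. Hclass \<alpha>0 \<alpha>1 \<gamma> (\<lambda>x p. H x p \<omega>'))
     \<longrightarrow>
       (-1 / \<alpha>0 \<le> Inf (range (\<lambda>(x, p). H x p \<omega>)) \<and>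
        Inf (range (\<lambda>(x, p). H x p \<omega>)) \<le> lambda0 (\<lambda>x. a x \<omega>) (\<lambda>x p. H x p \<omega>) \<and>
        lambda0 (\<lambda>x. a x \<omega>) (\<lambda>x p. H x p \<omega>) \<le> \<alpha>1) \<and>
       (lam \<ge> lambda0 (\<lambda>x. a x \<omega>) (\<lambda>x p. H x p \<omega>) \<longrightarrow>
          (\<exists>u. visc_sol (\<lambda>x. a x \<omega>) (\<lambda>x p. H x p \<omega>) lam u \<and>
               K-lipschitz_on UNIV u \<and>
               (\<forall>I. is_interval I \<and> open I \<and> I \<subseteq> {x. a x \<omega> > 0} \<longrightarrow> C2_on I u)))"
proof (intro allI exI impI, elim conjE)
  fix lam and a :: "real \<Rightarrow> 'w \<Rightarrow> real" and H :: "real \<Rightarrow> real \<Rightarrow> 'w \<Rightarrow> real" and \<omega>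
  assume a: "\<forall>x \<omega>'. 0 \<le> a x \<omega>' \<and> a x \<omega>' \<le> 1"
    and lip: "\<forall>\<omega>'. \<kappa>-lipschitz_on UNIV (\<lambda>x. sqrt (a x \<omega>'))"
    and H: "\<forall>\<omega>'. Hclass \<alpha>0 \<alpha>1 \<gamma> (\<lambda>x p. H x p \<omega>')"
  let ?a = "\<lambda>x. a x \<omega>" and ?H = "\<lambda>x p. H x p \<omega>"
  \<comment> \<open>Since \<open>a\<close> is nonnegative, it is the square of the Lipschitz
    function \<open>sqrt a\<close> and inherits continuity from it.\<close>
  have "continuous_on UNIV (\<lambda>x. (sqrt (a x \<omega>))\<^sup>2)"
    by (rule continuous_on_power[OF lipschitz_on_continuous_on[OF lip[rule_format]]])
  then have "continuous_on UNIV ?a" using a by simp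
  then have HJ: "viscous_HJ ?a ?H \<alpha>0 \<alpha>1 \<gamma>"
    using assms a H by unfold_locales auto
  then interpret viscous_HJ ?a ?H \<alpha>0 \<alpha>1 \<gamma> .
  have "\<exists>u. visc_sol ?a ?H lam u \<and> (grad_bound \<alpha>0 lam)-lipschitz_on UNIV u \<and>
      (\<forall>I. is_interval I \<and> open I \<and> I \<subseteq> {x. a x \<omega> > 0} \<longrightarrow> C2_on I u)"
    if le: "lambda0 ?a ?H \<le> lam"
  proof -
    obtain u0 where "visc_super ?a ?H lam u0"
      using exists_visc_super_above_lambda0[OF HJ le] by auto
    from solution_exists[OF this] obtain u where u: "(grad_bound \<alpha>0 lam)-lipschitz_on UNIV u"
      "\<And>x. super_at ?a ?H lam u x" "\<And>x. sub_at ?a ?H lam u x" by blast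
    have "continuous_on UNIV u" by (rule lipschitz_on_continuous_on[OF u(1)])
    then have "visc_sol ?a ?H lam u"
      using u by (auto simp: visc_sol_def visc_super_iff intro: visc_subI)
    with u C2_on_positive[OF u] show ?thesis by blast
  qed
  with lambda0_bounds[OF HJ]
  \<comment> \<open>The witness for \<open>K\<close> was left open before \<open>a\<close>,
    \<open>H\<close> and \<open>\<omega>\<close> were fixed, so it cannot depend on them; here it is
    filled by \<open>grad_bound \<alpha>0 lam\<close>.\<close>
  show "(-1 / \<alpha>0 \<le> Inf (range (\<lambda>(x, p). H x p \<omega>)) \<and>
        Inf (range (\<lambda>(x, p). H x p \<omega>)) \<le> lambda0 ?a ?H \<and> lambda0 ?a ?H \<le> \<alpha>1) \<and>
       (lam \<ge> lambda0 ?a ?H \<longrightarrow>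
          (\<exists>u. visc_sol ?a ?H lam u \<and> (grad_bound \<alpha>0 lam)-lipschitz_on UNIV u \<and>
               (\<forall>I. is_interval I \<and> open I \<and> I \<subseteq> {x. a x \<omega> > 0} \<longrightarrow> C2_on I u)))"
    by blast
qed

end
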